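(* For every integer $n\ge 1$, the thickness of the complete 4-partite graph $K_{1,1,n,n}$ is $$\theta(K_{1,1,n,n})=\left\lceil\frac{n+3}{4}\right\rceil.$$
   Context: All graphs are finite and simple. The thickness $\theta(G)$ of a graph $G$ is the minimum number of planar subgraphs of $G$ whose union is $G$. A complete $k$-partite graph is a graph whose vertex set can be partitioned into $k$ parts such that every edge has its ends in different parts and every two vertices in different parts are adjacent; $K_{p_1,\dots,p_k}$ denotes the complete $k$-partite graph whose $i$th part has $p_i$ vertices ($1\le i\le k$). *)

theory Defs
  imports "HOL-Analysis.Analysis"
begin

text \<open>Graphs are undirected; an edge is the two-element set of its ends.\<close>

datatype 'a graph = Graph (verts: "'a set") (edges: "'a set set")

definition simple_graph :: "'a graph \<Rightarrow> bool" where
  "simple_graph G \<longleftrightarrow> finite (verts G) \<and> (\<forall>e\<in>edges G. e \<subseteq> verts G \<and> card e = 2)"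

definition subgraph :: "'a graph \<Rightarrow> 'a graph \<Rightarrow> bool" where
  "subgraph H G \<longleftrightarrow> simple_graph H \<and> verts H \<subseteq> verts G \<and> edges H \<subseteq> edges G"

definition graph_Union :: "'a graph set \<Rightarrow> 'a graph" where
  "graph_Union \<H> = Graph (\<Union>H\<in>\<H>. verts H) (\<Union>H\<in>\<H>. edges H)"

text \<open>
  A drawing in the Euclidean plane, here the type \<^typ>\<open>complex\<close>: vertices are distinct points,
  edges are simple arcs joining their ends and passing through no other vertex, and two edges
  meet only in common ends.
\<close>

definition plane_drawing :: "'a graph \<Rightarrow> ('a \<Rightarrow> complex) \<Rightarrow> ('a set \<Rightarrow> real \<Rightarrow> complex) \<Rightarrow> bool" where
  "plane_drawing G p \<gamma> \<longleftrightarrow>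
     inj_on p (verts G) \<and>
     (\<forall>e\<in>edges G. arc (\<gamma> e) \<and> {pathstart (\<gamma> e), pathfinish (\<gamma> e)} = p ` e \<and>
        path_image (\<gamma> e) \<inter> p ` verts G = p ` e) \<and>
     (\<forall>e\<in>edges G. \<forall>f\<in>edges G. e \<noteq> f \<longrightarrow>
        path_image (\<gamma> e) \<inter> path_image (\<gamma> f) = p ` (e \<inter> f))"

definition planar :: "'a graph \<Rightarrow> bool" where
  "planar G \<longleftrightarrow> (\<exists>p \<gamma>. plane_drawing G p \<gamma>)"

text \<open>
  For a finite simple graph the \<open>LEAST\<close> ranges over a nonempty set: take its one-vertex subgraphs
  and its single-edge subgraphs.
\<close>

definition thickness :: "'a graph \<Rightarrow> nat" where
  "thickness G = (LEAST k. \<exists>\<H>. finite \<H> \<and> card \<H> = k \<and>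
     (\<forall>H\<in>\<H>. subgraph H G \<and> planar H) \<and> graph_Union \<H> = G)"

text \<open>
  For \<open>ps = [p\<^sub>1, \<dots>, p\<^sub>k]\<close> this is \<open>K\<close> with parts of sizes \<open>p\<^sub>1, \<dots>, p\<^sub>k\<close>: the vertex \<open>(i, j)\<close> is the
  \<open>j\<close>th vertex of the \<open>i\<close>th part, with both indices counted from 0.
\<close>

definition complete_multipartite :: "nat list \<Rightarrow> (nat \<times> nat) graph" where
  "complete_multipartite ps =
     (let V = {(i, j). i < length ps \<and> j < ps ! i}
      in Graph V {{u, v} | u v. u \<in> V \<and> v \<in> V \<and> fst u \<noteq> fst v})"

lemma simple_graph_complete_multipartite: "simple_graph (complete_multipartite ps)"
proof -
  have "{(i, j). i < length ps \<and> j < ps ! i} = Sigma {..<length ps} (\<lambda>i. {..<ps ! i})"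
    by auto
  then have "finite {(i, j). i < length ps \<and> j < ps ! i}"
    by simp
  moreover have "card {u, v} = 2" if "fst u \<noteq> fst v" for u v :: "nat \<times> nat"
  proof -
    from that have "u \<noteq> v" by auto
    then show ?thesis by simp
  qed
  ultimately show ?thesis
    unfolding simple_graph_def complete_multipartite_def Let_def graph.sel by blast
qed

end

theory Submission
  imports Defs
begin

text \<open>
  Lower bound. A bipartite plane graph on \<open>N \<ge> 3\<close> vertices has at most \<open>2 N - 4\<close> edges. Instead of
  Euler's formula, Janiszewski's theorem and the Jordan curve theorem are applied directly to unions of
  edges: an edge joining two linked vertices closes a Jordan curve, so adding the edges outside a spanning
  forest \<open>T\<close> one by one yields \<open>m - |T| + 1\<close> pairwise separated points; every edge borders at most two
  faces and every face is bordered by at least four edges. As \<open>K\<^bsub>1,1,n,n\<^esub>\<close> contains \<open>K\<^bsub>n+1,n+1\<^esub>\<close>, a cover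
  by \<open>k\<close> planar graphs satisfies \<open>(n + 1)\<^sup>2 \<le> 4 n k\<close>, hence \<open>4 k \<ge> n + 3\<close>.

  Upper bound. For \<open>n \<le> 4 p + 1\<close> there are \<open>p + 1\<close> covering graphs, all of them subgraphs of stacked
  triangulations, which are drawn with straight edges by putting each new vertex at the centroid of a face.
  For \<open>p \<ge> 3\<close> the vertices are grouped into \<open>p\<close> blocks of four and four. The \<open>r\<close>th graph contains 12 of the
  16 edges inside block \<open>r\<close> and joins every vertex outside the block to two vertices of the block, except that
  the two dominating vertices are also joined to two vertices of blocks \<open>r + 1\<close> and \<open>r + 2\<close> each; the last
  graph collects the remaining edges. The cases \<open>p = 1\<close> and \<open>p = 2\<close> were found by computer search.
\<close>

subsection \<open>Forests and bipartite graphs\<close>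

definition linked :: "'a set set \<Rightarrow> 'a \<Rightarrow> 'a \<Rightarrow> bool" where
  "linked D = (\<lambda>x y. {x, y} \<in> D)\<^sup>*\<^sup>*"

lemma linked_refl [simp]: "linked D x x"
  by (simp add: linked_def)

lemma linked_edge: "{x, y} \<in> D \<Longrightarrow> linked D x y"
  by (simp add: linked_def r_into_rtranclp)

lemma linked_trans: "linked D x y \<Longrightarrow> linked D y z \<Longrightarrow> linked D x z"
  unfolding linked_def by (rule rtranclp_trans)

lemma linked_sym: "linked D x y \<Longrightarrow> linked D y x"
  unfolding linked_def
  by (rule sympD [OF symp_rtranclp]) (auto simp: symp_def insert_commute)

lemma linked_mono: "linked D x y \<Longrightarrow> D \<subseteq> D' \<Longrightarrow> linked D' x y"
  unfolding linked_def by (erule rtranclp_mono [THEN predicate2D, rotated]) auto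

text \<open>Mostly used contrapositively: if \<open>y\<close> lies outside \<open>S\<close>, some
  edge of \<open>D\<close> leaves \<open>S\<close>.\<close>

lemma linked_closed:
  assumes "linked D x y" "x \<in> S" and "\<And>a b. {a, b} \<in> D \<Longrightarrow> a \<in> S \<Longrightarrow> b \<in> S"
  shows "y \<in> S"
  using assms(1,2) unfolding linked_def by (induction rule: rtranclp_induct) (auto intro: assms(3))

text \<open>Acyclicity is encoded by an order of construction, in which each edge joins two classes
  that are not yet linked; this is the induction needed for counting and for plane separation. A
  loop is excluded because \<open>linked\<close> is reflexive.\<close>

inductive forest :: "'a set set \<Rightarrow> bool" where
  empty: "forest {}"
| insert: "forest T \<Longrightarrow> \<not> linked T u v \<Longrightarrow> forest (insert {u, v} T)"

lemma finite_forest: "forest T \<Longrightarrow> finite T"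
  by (induction rule: forest.induct) auto

text \<open>Greedy choice: run through the edges and keep one exactly when its ends are not yet
  linked.\<close>

lemma spanning_forest_exists:
  assumes "finite D" and "\<And>e. e \<in> D \<Longrightarrow> card e = 2"
  obtains T where "T \<subseteq> D" "forest T" "\<And>u v. {u, v} \<in> D \<Longrightarrow> linked T u v"
proof -
  have "\<exists>T\<subseteq>D. forest T \<and> (\<forall>u v. {u, v} \<in> D \<longrightarrow> linked T u v)"
    using assms
  proof (induction D rule: finite_induct)
    case empty
    then show ?case by (auto intro: forest.empty)
  next
    case (insert e D)
    then obtain T where T: "T \<subseteq> D" "forest T" "\<And>u v. {u, v} \<in> D \<Longrightarrow> linked T u v"
      by auto
    obtain x y where e: "e = {x, y}"
      using insert.prems [of e] by (auto simp: card_2_iff)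
    show ?case
    proof (cases "linked T x y")
      case True
      then have "linked T u v" if "{u, v} \<in> insert e D" for u v
        using that T(3) e linked_sym [OF True] by (auto simp: doubleton_eq_iff)
      with T show ?thesis by (intro exI [of _ T]) auto
    next
      case False
      then have "forest (insert e T)"
        unfolding e by (intro forest.insert T)
      moreover have "linked (insert e T) u v" if "{u, v} \<in> insert e D" for u v
        using that T(3) [of u v] by (auto intro: linked_edge linked_mono [of T])
      ultimately show ?thesis
        using T(1) by (intro exI [of _ "insert e T"]) auto
    qed
  qed
  then show thesis using that by blast
qed

text \<open>Each edge of a forest merges two classes of \<open>linked\<close>, so the number of
  classes meeting \<open>V\<close> drops at least as fast as edges are added.\<close>

lemma forest_card_classes:
  assumes "forest T" "finite V" "\<Union>T \<subseteq> V"
  shows "card T + card ((\<lambda>x. Collect (linked T x)) ` V) \<le> card V"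
  using assms
proof (induction rule: forest.induct)
  case empty
  then show ?case by (simp add: card_image_le)
next
  case (insert T u v)
  define f where "f x = Collect (linked T x)" for x
  define f' where "f' x = Collect (linked (insert {u, v} T) x)" for x
  \<comment> \<open>\<open>g\<close> sends an old class to the new class that contains it, through a
    chosen representative.\<close>
  define g where "g c = f' (SOME x. f x = c)" for c
  have f_eq: "f x = f y \<longleftrightarrow> linked T x y" for x y
    unfolding f_def by (auto intro: linked_trans linked_sym)
  have f'_eq: "f' x = f' y \<longleftrightarrow> linked (insert {u, v} T) x y" for x y
    unfolding f'_def by (auto intro: linked_trans linked_sym)
  have g: "g (f x) = f' x" for x
  proof -
    have "f (SOME y. f y = f x) = f x"
      by (rule someI) (rule refl)
    then show ?thesis
      unfolding g_def f'_eq f_eq by (rule linked_mono) auto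
  qed
  have uv: "f' u = f' v"
    unfolding f'_eq by (rule linked_edge) auto
  have "f' ` V \<subseteq> g ` (f ` V - {f v})"
  proof
    fix c assume "c \<in> f' ` V"
    then obtain x where x: "x \<in> V" "c = f' x" by auto
    show "c \<in> g ` (f ` V - {f v})"
    proof (cases "f x = f v")
      case True
      then have "c = g (f u)"
        using x uv g [of x] g [of v] g [of u] by simp
      moreover have "f u \<noteq> f v"
        using insert.hyps(2) f_eq by simp
      moreover have "u \<in> V" using insert.prems by auto
      ultimately show ?thesis by blast
    next
      case False
      then show ?thesis using x g [of x] by auto
    qed
  qed
  then have "card (f' ` V) \<le> card (g ` (f ` V - {f v}))"
    using insert.prems by (intro card_mono) auto
  also have "\<dots> \<le> card (f ` V - {f v})"
    using insert.prems by (intro card_image_le) auto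
  also have "\<dots> < card (f ` V)"
    using insert.prems by (intro psubset_card_mono) auto
  finally have "card (f' ` V) < card (f ` V)" .
  moreover have "card (insert {u, v} T) \<le> Suc (card T)"
    by (simp add: card_insert_le_m1 card_insert_if finite_forest insert.hyps)
  moreover have "card T + card (f ` V) \<le> card V"
    using insert.IH insert.prems unfolding f_def by auto
  ultimately show ?case unfolding f'_def by linarith
qed

lemma forest_card_less:
  assumes "forest T" "finite V" "\<Union>T \<subseteq> V" "V \<noteq> {}"
  shows "card T < card V"
proof -
  have "card ((\<lambda>x. Collect (linked T x)) ` V) > 0"
    using assms by (simp add: card_gt_0_iff)
  then show ?thesis using forest_card_classes [OF assms(1-3)] by linarith
qed

text \<open>An edge \<open>e\<close> outside a spanning forest closes a cycle, and a bipartite cycle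
  is not a triangle: the forest contains an edge at each end of \<open>e\<close>, these two are
  disjoint, and a third one is needed to connect them.\<close>

lemma bipartite_not_forest_card_ge_4:
  assumes fin: "finite D" and bip: "\<And>e. e \<in> D \<Longrightarrow> \<exists>u v. u \<in> A \<and> v \<notin> A \<and> e = {u, v}"
    and nf: "\<not> forest D"
  shows "card D \<ge> 4"
proof -
  have "card e = 2" if "e \<in> D" for e
    using bip [OF that] by (auto simp: card_2_iff)
  with fin obtain T where T: "T \<subseteq> D" "forest T" "\<And>u v. {u, v} \<in> D \<Longrightarrow> linked T u v"
    by (metis spanning_forest_exists)
  with nf have "T \<noteq> D" by auto
  with T(1) obtain e where e: "e \<in> D" "e \<notin> T" by blast
  obtain u v where uv: "u \<in> A" "v \<notin> A" "e = {u, v}" using bip [OF e(1)] by blast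
  have link: "linked T u v" using T(3) e(1) uv by blast
  have edge: "{x, y} \<in> T \<Longrightarrow> (x \<in> A) \<noteq> (y \<in> A)" for x y
    using bip [of "{x, y}"] T(1) by (auto simp: doubleton_eq_iff)
  obtain w where w: "{u, w} \<in> T"
    using linked_closed [OF link, of "{u}"] uv by auto
  obtain x where x: "{v, x} \<in> T"
    using linked_closed [OF linked_sym [OF link], of "{v}"] uv by auto
  have ne: "w \<notin> A" "x \<in> A" "w \<noteq> v" "x \<noteq> u" "{u, w} \<noteq> {v, x}"
    using edge [OF w] edge [OF x] uv w x e by (auto simp: doubleton_eq_iff insert_commute)
  obtain h where h: "h \<in> T" "h \<noteq> {u, w}" "h \<noteq> {v, x}"
  proof (rule ccontr)
    assume "\<not> thesis"
    \<comment> \<open>With only these two edges in \<open>T\<close>, the set \<open>{u, w}\<close>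
      would be closed under adjacency, although \<open>v\<close> is linked to
      \<open>u\<close>.\<close>
    with that have T2: "\<And>h. h \<in> T \<Longrightarrow> h = {u, w} \<or> h = {v, x}" by blast
    have "v \<in> {u, w}"
    proof (rule linked_closed [OF link])
      fix a b assume "{a, b} \<in> T" "a \<in> {u, w}"
      then show "b \<in> {u, w}"
        using T2 [of "{a, b}"] ne uv by (auto simp: doubleton_eq_iff)
    qed simp
    then show False using ne uv by auto
  qed
  have "card {e, {u, w}, {v, x}, h} = 4"
    using ne h e w x by (auto simp: card_insert_if)
  moreover have "{e, {u, w}, {v, x}, h} \<subseteq> D"
    using e w x h T by auto
  ultimately show ?thesis using card_mono [OF fin] by metis
qed

subsection \<open>Separation by plane graphs\<close>

text \<open>A drawing reduced to its edges: only ends of edges count as vertices, so any set of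
  edges chosen from a plane drawing of a simple graph gives an instance.\<close>

locale plane_edges =
  fixes E :: "'a set set" and p :: "'a \<Rightarrow> complex" and \<gamma> :: "'a set \<Rightarrow> real \<Rightarrow> complex"
  assumes finite_E: "finite E"
    and card_edge: "e \<in> E \<Longrightarrow> card e = 2"
    and inj_p: "inj_on p (\<Union>E)"
    and arc_edge: "e \<in> E \<Longrightarrow> arc (\<gamma> e)"
    and ends_edge: "e \<in> E \<Longrightarrow> {pathstart (\<gamma> e), pathfinish (\<gamma> e)} = p ` e"
    and edge_Int_edge: "e \<in> E \<Longrightarrow> f \<in> E \<Longrightarrow> e \<noteq> f \<Longrightarrow>
      path_image (\<gamma> e) \<inter> path_image (\<gamma> f) = p ` (e \<inter> f)"
    and edge_Int_verts: "e \<in> E \<Longrightarrow> path_image (\<gamma> e) \<inter> p ` \<Union>E = p ` e"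
begin

definition pts :: "'a set set \<Rightarrow> complex set" where
  "pts D = (\<Union>e\<in>D. path_image (\<gamma> e))"

definition open_edge :: "'a set \<Rightarrow> complex set" where
  "open_edge e = path_image (\<gamma> e) - p ` e"

abbreviation same_face :: "'a set set \<Rightarrow> complex \<Rightarrow> complex \<Rightarrow> bool" where
  "same_face D \<equiv> connected_component (- pts D)"

lemma pts_empty [simp]: "pts {} = {}"
  by (simp add: pts_def)

lemma pts_insert [simp]: "pts (insert e D) = path_image (\<gamma> e) \<union> pts D"
  by (simp add: pts_def)

lemma pts_Un: "pts (D \<union> D') = pts D \<union> pts D'"
  by (simp add: pts_def)

lemma pts_mono: "D \<subseteq> D' \<Longrightarrow> pts D \<subseteq> pts D'"
  by (auto simp: pts_def)

lemma compact_edge: "e \<in> E \<Longrightarrow> compact (path_image (\<gamma> e))"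
  by (simp add: arc_edge compact_arc_image)

lemma compact_pts: "D \<subseteq> E \<Longrightarrow> compact (pts D)"
  unfolding pts_def using finite_subset [OF _ finite_E]
  by (intro compact_UN) (auto intro: compact_edge)

lemma closed_pts: "D \<subseteq> E \<Longrightarrow> closed (pts D)"
  by (simp add: compact_pts compact_imp_closed)

lemma ends_in_edge: "e \<in> E \<Longrightarrow> p ` e \<subseteq> path_image (\<gamma> e)"
  using pathstart_in_path_image [of "\<gamma> e"] pathfinish_in_path_image [of "\<gamma> e"]
  by (simp flip: ends_edge)

lemma pts_Int_pts:
  assumes "D \<subseteq> E" "D' \<subseteq> E" "D \<inter> D' = {}"
  shows "pts D \<inter> pts D' \<subseteq> p ` (\<Union>D \<inter> \<Union>D')"
proof
  fix x assume "x \<in> pts D \<inter> pts D'"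
  then obtain e f where ef: "e \<in> D" "f \<in> D'" "x \<in> path_image (\<gamma> e)" "x \<in> path_image (\<gamma> f)"
    by (auto simp: pts_def)
  then have "x \<in> p ` (e \<inter> f)"
    using assms edge_Int_edge [of e f] by auto
  then show "x \<in> p ` (\<Union>D \<inter> \<Union>D')" using ef by blast
qed

lemma edge_Int_pts:
  assumes "D \<subseteq> E" "e \<in> E" "e \<notin> D"
  shows "path_image (\<gamma> e) \<inter> pts D \<subseteq> p ` (e \<inter> \<Union>D)"
  using pts_Int_pts [of "{e}" D] assms by simp

lemma open_edge_Int_pts:
  assumes "D \<subseteq> E" "e \<in> E" "e \<notin> D"
  shows "open_edge e \<inter> pts D = {}"
  using edge_Int_pts [OF assms] by (auto simp: open_edge_def)

lemma open_edge_verts: "e \<in> E \<Longrightarrow> open_edge e \<inter> p ` \<Union>E = {}"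
  using edge_Int_verts [of e] by (auto simp: open_edge_def)

lemma connected_open_edge: "e \<in> E \<Longrightarrow> connected (open_edge e)"
  unfolding open_edge_def ends_edge [symmetric]
  by (simp add: arc_edge arc_imp_simple_path connected_simple_path_endless)

lemma open_edge_nonempty: "e \<in> E \<Longrightarrow> open_edge e \<noteq> {}"
  unfolding open_edge_def ends_edge [symmetric]
  by (simp add: arc_edge arc_imp_simple_path simple_path_endless nonempty_simple_path_endless)

text \<open>The edges of a walk chain up to a path inside \<open>pts D\<close>, and a path with
  distinct ends contains an arc with the same ends.\<close>

lemma arc_of_linked:
  assumes D: "D \<subseteq> E" and link: "linked D u v" and "u \<noteq> v"
  obtains g where "arc g" "path_image g \<subseteq> pts D" "pathstart g = p u" "pathfinish g = p v"
proof -
  have link_edge: "path_component (pts D) (p x) (p y)" if "{x, y} \<in> D" for x y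
  proof -
    have e: "{x, y} \<in> E" using that D by auto
    have "path_component (path_image (\<gamma> {x, y})) (p x) (p y)"
      using path_connected_path_image [OF arc_imp_path [OF arc_edge [OF e]]] ends_in_edge [OF e]
      by (auto simp: path_connected_component)
    then show ?thesis
      by (rule path_component_of_subset [rotated]) (use that in \<open>auto simp: pts_def\<close>)
  qed
  \<comment> \<open>The trivial walk is kept apart: its vertex may lie on no edge of
    \<open>D\<close>, and then its point need not belong to \<open>pts D\<close>.\<close>
  have "u = v \<or> u \<in> \<Union>D \<and> v \<in> \<Union>D \<and> path_component (pts D) (p u) (p v)"
    using link unfolding linked_def
  proof (induction rule: rtranclp_induct)
    case (step y z)
    have "y \<in> \<Union>D" "z \<in> \<Union>D" using step.hyps(2) by auto
    then show ?case
      using step.IH link_edge [OF step.hyps(2)] path_component_trans by metis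
  qed auto
  with \<open>u \<noteq> v\<close> have *: "u \<in> \<Union>D" "v \<in> \<Union>D" "path_component (pts D) (p u) (p v)" by auto
  have "p u \<noteq> p v"
    using inj_onD [OF inj_p, of u v] * \<open>u \<noteq> v\<close> D by blast
  obtain h where h: "path h" "path_image h \<subseteq> pts D" "pathstart h = p u" "pathfinish h = p v"
    using *(3) by (auto simp: path_component_def)
  then show thesis
    using path_contains_arc [OF h(1,3,4) \<open>p u \<noteq> p v\<close>] that by (metis order_trans)
qed

text \<open>The edge closes an arc through \<open>D\<close> to a Jordan curve. The curve meets
  \<open>pts D\<close> exactly in that arc, which gives the connected intersection that
  Janiszewski's theorem requires.\<close>

lemma loop_of_linked:
  assumes D: "D \<subseteq> E" and e: "{u, v} \<in> E" "{u, v} \<notin> D" and link: "linked D u v"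
  obtains c where "simple_path c" "pathfinish c = pathstart c"
    "path_image (\<gamma> {u, v}) \<subseteq> path_image c" "path_image c \<subseteq> pts (insert {u, v} D)"
    "connected (pts D \<inter> path_image c)"
proof -
  have "u \<noteq> v" using card_edge [OF e(1)] by auto
  then obtain g where g: "arc g" "path_image g \<subseteq> pts D" "pathstart g = p u" "pathfinish g = p v"
    using arc_of_linked [OF D link] by blast
  \<comment> \<open>A drawing fixes only the set of the two ends of an edge; \<open>h\<close> is the
    edge directed from \<open>v\<close> to \<open>u\<close>.\<close>
  define h where "h = (if pathstart (\<gamma> {u, v}) = p v then \<gamma> {u, v} else reversepath (\<gamma> {u, v}))"
  have pv: "p u \<noteq> p v"
    using g(1,3,4) arc_distinct_ends by fastforce
  have h: "arc h" "path_image h = path_image (\<gamma> {u, v})" "pathstart h = p v" "pathfinish h = p u"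
    using ends_edge [OF e(1)] arc_edge [OF e(1)] pv
    by (auto simp: h_def arc_reversepath doubleton_eq_iff)
  have Int: "path_image h \<inter> pts D \<subseteq> {p u, p v}"
    using edge_Int_pts [OF D e] h(2) by auto
  have uv: "p u \<in> path_image g" "p v \<in> path_image g"
    using pathstart_in_path_image [of g] pathfinish_in_path_image [of g] g by auto
  have image: "path_image (g +++ h) = path_image g \<union> path_image h"
    using g h by (simp add: path_image_join)
  show thesis
  proof (rule that [of "g +++ h"])
    show "simple_path (g +++ h)"
      using g h Int by (intro simple_path_join_loop) auto
    have "pts D \<inter> path_image (g +++ h) = path_image g"
      unfolding image using Int g(2) uv by blast
    then show "connected (pts D \<inter> path_image (g +++ h))"
      by (simp add: connected_arc_image g(1))
    show "path_image (\<gamma> {u, v}) \<subseteq> path_image (g +++ h)" "path_image (g +++ h) \<subseteq> pts (insert {u, v} D)"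
      unfolding image using g(2) h(2) by auto
  qed (use g h in simp_all)
qed

text \<open>Janiszewski's theorem: if neither of two closed sets, one of them compact, separates
  \<open>a\<close> from \<open>b\<close> and their intersection is connected, then their union does
  not separate them. Here the sets are \<open>pts D\<close> and the curve.\<close>

lemma same_face_insert_loop:
  assumes D: "D \<subseteq> E"
    and c: "simple_path c" "path_image (\<gamma> e) \<subseteq> path_image c" "path_image c \<subseteq> pts (insert e D)"
      "connected (pts D \<inter> path_image c)"
    and "same_face D a b" "connected_component (- path_image c) a b"
  shows "same_face (insert e D) a b"
proof -
  have "pts (insert e D) = pts D \<union> path_image c" using c(2,3) by auto
  then show ?thesis
    using Janiszewski [OF compact_pts [OF D] closed_simple_path_image [OF c(1)] c(4)] assms(6,7)
    by metis
qed

text \<open>Janiszewski's theorem is applied twice: the new edge meets the edges not linked to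
  \<open>u\<close> at most in the point of \<open>v\<close>, and their union meets the component of
  \<open>u\<close> at most in the point of \<open>u\<close>.\<close>

lemma same_face_insert_bridge:
  assumes D: "D \<subseteq> E" and e: "{u, v} \<in> E" and unlinked: "\<not> linked D u v"
    and same: "same_face D a b" and off: "a \<notin> path_image (\<gamma> {u, v})" "b \<notin> path_image (\<gamma> {u, v})"
  shows "same_face (insert {u, v} D) a b"
proof -
  \<comment> \<open>\<open>K\<close> collects the edges in the component of \<open>u\<close>, and
    \<open>R\<close> all the others, among them those in the component of \<open>v\<close>.\<close>
  define K where "K = {f \<in> D. \<exists>x\<in>f. linked D u x}"
  define R where "R = D - K"
  have KR: "K \<subseteq> E" "R \<subseteq> E" "K \<inter> R = {}" "D = K \<union> R"
    using D by (auto simp: K_def R_def)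
  have notin: "{u, v} \<notin> D"
    using unlinked linked_edge by metis
  have linked_K: "linked D u y" if y: "y \<in> \<Union>K" for y
  proof -
    obtain f x where f: "f \<in> D" "x \<in> f" "y \<in> f" "linked D u x"
      using y by (auto simp: K_def)
    have "f = {x, y} \<or> x = y"
      using card_edge [of f] f D by (auto simp: card_2_iff)
    then show ?thesis using f linked_edge linked_trans by metis
  qed
  have not_linked_R: "\<not> linked D u y" if "y \<in> \<Union>R" for y
    using that by (auto simp: K_def R_def)
  have sub: "same_face K a b" "same_face R a b"
    using same KR(4) by (auto elim!: connected_component_of_subset simp: pts_Un)
  have e_conn: "connected_component (- path_image (\<gamma> {u, v})) a b"
    using connected_arc_complement [OF arc_edge [OF e]] off
    by (simp add: connected_iff_connected_component)
  have "path_image (\<gamma> {u, v}) \<inter> pts R \<subseteq> {p v}"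
    using edge_Int_pts [of R "{u, v}"] KR e notin not_linked_R by (auto simp: subset_iff) fastforce
  then have "connected (path_image (\<gamma> {u, v}) \<inter> pts R)"
    by (metis connected_empty connected_sing subset_singletonD)
  from Janiszewski [OF compact_edge [OF e] closed_pts [OF KR(2)] this e_conn sub(2)]
  have eR: "same_face (insert {u, v} R) a b" by simp
  have "pts K \<inter> pts (insert {u, v} R) \<subseteq> p ` (\<Union>K \<inter> \<Union>(insert {u, v} R))"
    by (rule pts_Int_pts) (use KR e notin in auto)
  also have "\<dots> \<subseteq> {p u}"
    using linked_K not_linked_R unlinked by auto
  finally have "connected (pts K \<inter> pts (insert {u, v} R))"
    by (metis connected_empty connected_sing subset_singletonD)
  from Janiszewski [OF compact_pts [OF KR(1)] closed_pts this sub(1) eR] e KR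
  show ?thesis by (simp add: pts_Un Un_ac)
qed

text \<open>By its construction order, a forest is built from bridges only, and an added bridge
  separates nothing.\<close>

lemma forest_same_face:
  assumes "forest T" "T \<subseteq> E" "a \<notin> pts T" "b \<notin> pts T"
  shows "same_face T a b"
  using assms
proof (induction rule: forest.induct)
  case empty
  then show ?case by (simp add: connected_UNIV connected_iff_connected_component [THEN iffD1])
next
  case (insert T u v)
  then show ?case by (intro same_face_insert_bridge) auto
qed


text \<open>The new edge runs through one face of \<open>D\<close> and closes a Jordan curve, which
  cuts this face: its representative in \<open>X\<close>, if there is one, gives way to one point
  inside and one point outside the curve.\<close>

lemma separated_points_insert:
  assumes D: "D \<subseteq> E" and e: "{u, v} \<in> E" "{u, v} \<notin> D" and link: "linked D u v"
    and X: "finite X" "X \<inter> pts D = {}" "pairwise (\<lambda>x y. \<not> same_face D x y) X"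
  obtains X' where "finite X'" "X' \<inter> pts (insert {u, v} D) = {}"
    "pairwise (\<lambda>x y. \<not> same_face (insert {u, v} D) x y) X'" "card X < card X'"
proof -
  let ?e = "{u, v}"
  obtain c where c: "simple_path c" "pathfinish c = pathstart c"
    "path_image (\<gamma> ?e) \<subseteq> path_image c" "path_image c \<subseteq> pts (insert ?e D)"
    using loop_of_linked [OF D e link] by metis
  note J = Jordan_inside_outside [OF c(1,2)]
  have J12: "inside (path_image c) \<inter> outside (path_image c) = {}"
    "x \<in> inside (path_image c) \<or> x \<in> outside (path_image c) \<longleftrightarrow> x \<notin> path_image c" for x
    using J by blast+
  obtain q where q: "q \<in> open_edge ?e" using open_edge_nonempty [OF e(1)] by blast
  \<comment> \<open>\<open>F\<close> is the face of \<open>D\<close> that contains the interior of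
    the new edge.\<close>
  define F where "F = connected_component_set (- pts D) q"
  have qF: "q \<in> F"
    using open_edge_Int_pts [OF D e] q by (auto simp: F_def)
  have "open F"
    using closed_pts [OF D] by (auto simp: F_def intro: open_connected_component)
  have eF: "open_edge ?e \<subseteq> F"
    unfolding F_def using open_edge_Int_pts [OF D e] q
    by (intro connected_component_maximal connected_open_edge e) auto
  have qc: "q \<in> path_image c" using q c(3) by (auto simp: open_edge_def)
  \<comment> \<open>Every point of a Jordan curve lies on the frontier of both sides, so the open
    set \<open>F\<close> around \<open>q\<close> meets both.\<close>
  have "q \<in> closure (inside (path_image c))" "q \<in> closure (outside (path_image c))"
    using J qc by (auto simp: frontier_def)
  then have "F \<inter> inside (path_image c) \<noteq> {}" "F \<inter> outside (path_image c) \<noteq> {}"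
    using open_Int_closure_eq_empty [OF \<open>open F\<close>] qF by blast+
  then obtain y z where yz: "y \<in> F" "y \<in> inside (path_image c)" "z \<in> F" "z \<in> outside (path_image c)"
    by blast
  have F_off: "F \<inter> pts D = {}"
    using connected_component_subset [of "- pts D" q] by (auto simp: F_def)
  have yz_off: "y \<notin> pts (insert ?e D)" "z \<notin> pts (insert ?e D)"
    using F_off yz J12 c(3) by auto
  have "u \<noteq> v" using card_edge [OF e(1)] by auto
  then have "u \<in> \<Union>D" "v \<in> \<Union>D"
    using linked_closed [OF link, of "{u}"] linked_closed [OF linked_sym [OF link], of "{v}"] by auto
  then have "p ` ?e \<subseteq> pts D"
    using ends_in_edge D by (fastforce simp: pts_def)
  then have e_sub: "path_image (\<gamma> ?e) \<subseteq> F \<union> pts D"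
    using eF by (auto simp: open_edge_def)
  have not_same_F: "\<not> same_face D x y" if "x \<in> F" "y \<notin> F" for x y
    using that connected_component_trans by (fastforce simp: F_def)
  have yz_sep: "\<not> same_face (insert ?e D) y z"
  proof
    assume "same_face (insert ?e D) y z"
    then obtain S where S: "connected S" "S \<subseteq> - pts (insert ?e D)" "y \<in> S" "z \<in> S"
      by (auto simp: connected_component_def)
    have "S \<subseteq> inside (path_image c) \<union> outside (path_image c)"
      using S(2) c(4) J12(2) by blast
    moreover have "inside (path_image c) \<inter> outside (path_image c) \<inter> S = {}"
      using J12(1) by simp
    moreover have "open (inside (path_image c))" "open (outside (path_image c))"
      using J by auto
    ultimately have "inside (path_image c) \<inter> S = {} \<or> outside (path_image c) \<inter> S = {}"
      using connectedD [OF S(1)] by metis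
    then show False using S(3,4) yz by auto
  qed
  have new: "\<not> same_face (insert ?e D) x y" if "\<not> same_face D x y" for x y
    using that connected_component_of_subset [of "- pts (insert ?e D)" x y "- pts D"] by auto
  have XF: "card (X \<inter> F) \<le> 1"
  proof (rule ccontr)
    assume "\<not> card (X \<inter> F) \<le> 1"
    then obtain x x' where x: "x \<in> X \<inter> F" "x' \<in> X \<inter> F" "x \<noteq> x'"
      by (metis card_le_Suc0_iff_eq X(1) One_nat_def finite_Int)
    then have "same_face D x x'"
      using connected_component_sym connected_component_trans by (fastforce simp: F_def)
    then show False using X(3) x by (auto simp: pairwise_def)
  qed
  \<comment> \<open>At most one point of \<open>X\<close> is lost, since \<open>F\<close> is a
    single face, and two are gained. The points kept avoid the new edge, which lies in
    \<open>F\<close> and \<open>pts D\<close>.\<close>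
  define X' where "X' = insert y (insert z (X - F))"
  show thesis
  proof
    show "finite X'" using X(1) by (simp add: X'_def)
    show "X' \<inter> pts (insert ?e D) = {}"
      using X(2) yz_off e_sub by (auto simp: X'_def)
    have "\<not> same_face D x' x" if "x \<in> X - F" "x' \<in> {y, z}" for x x'
      using not_same_F [of x' x] that yz by auto
    then show "pairwise (\<lambda>x y. \<not> same_face (insert ?e D) x y) X'"
      using X(3) yz_sep new connected_component_sym_eq
      unfolding X'_def pairwise_insert by (smt (verit) DiffD1 insert_iff pairwise_def)
    have "y \<noteq> z" using yz J12(1) by blast
    then have "card X' = card (X - F) + 2"
      using X(1) yz by (simp add: X'_def)
    moreover have "card X = card (X - F) + card (X \<inter> F)"
      using X(1) by (metis card_Diff_subset_Int card_Int_Diff add.commute)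
    ultimately show "card X < card X'" using XF by linarith
  qed
qed

text \<open>The half of Euler's formula that bounds the number of faces from below: one point off
  the forest to begin with, and at least one more for each remaining edge, as its ends are linked in
  \<open>T\<close>.\<close>

lemma separated_points_exist:
  assumes T: "forest T" "T \<subseteq> E" and span: "\<And>u v. {u, v} \<in> E \<Longrightarrow> linked T u v"
  obtains X where "finite X" "X \<inter> pts E = {}" "pairwise (\<lambda>x y. \<not> same_face E x y) X"
    "card E < card X + card T"
proof -
  have "\<exists>X. finite X \<and> X \<inter> pts (T \<union> S) = {} \<and> pairwise (\<lambda>x y. \<not> same_face (T \<union> S) x y) X \<and>
      card S < card X" if "finite S" "S \<subseteq> E - T" for S
    using that
  proof (induction S rule: finite_induct)
    case empty
    have "pts T \<noteq> UNIV"
      using compact_pts [OF T(2)] not_bounded_UNIV compact_imp_bounded by metis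
    then obtain x where "x \<notin> pts T" by auto
    then show ?case by (intro exI [of _ "{x}"]) auto
  next
    case (insert e S)
    then obtain X where X: "finite X" "X \<inter> pts (T \<union> S) = {}"
      "pairwise (\<lambda>x y. \<not> same_face (T \<union> S) x y) X" "card S < card X"
      by auto
    have "e \<in> E" using insert.prems by auto
    then obtain u v where e: "e = {u, v}"
      using card_edge [OF \<open>e \<in> E\<close>] by (auto simp: card_2_iff)
    have "linked T u v"
      using span \<open>e \<in> E\<close> e by simp
    then have "linked (T \<union> S) u v"
      by (rule linked_mono) simp
    moreover have sub: "T \<union> S \<subseteq> E" and notin: "{u, v} \<notin> T \<union> S"
      using T(2) insert.hyps insert.prems e by auto
    ultimately obtain X' where X': "finite X'" "X' \<inter> pts (insert e (T \<union> S)) = {}"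
      "pairwise (\<lambda>x y. \<not> same_face (insert e (T \<union> S)) x y) X'" "card X < card X'"
      using separated_points_insert [OF sub _ notin _ X(1-3)] \<open>e \<in> E\<close> unfolding e by metis
    moreover have "T \<union> insert e S = insert e (T \<union> S)" by simp
    moreover have "card (insert e S) < card X'"
      using X(4) X'(4) insert.hyps by simp
    ultimately show ?case by metis
  qed
  from this [of "E - T"] obtain X where "finite X" "X \<inter> pts E = {}"
    "pairwise (\<lambda>x y. \<not> same_face E x y) X" "card (E - T) < card X"
    using finite_E Un_Diff_cancel Un_absorb1 [OF T(2)] by (metis finite_Diff order_refl)
  moreover have "card E = card (E - T) + card T"
    using card_Diff_subset [OF finite_forest [OF T(1)] T(2)] card_mono [OF finite_E T(2)] by simp
  ultimately show thesis using that [of X] by simp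
qed

text \<open>Only the interior of an edge counts, since an end may lie on the frontier of a face that
  the edge does not border.\<close>

definition border :: "complex \<Rightarrow> 'a set set" where
  "border x = {e \<in> E. frontier (connected_component_set (- pts E) x) \<inter> open_edge e \<noteq> {}}"

lemma border_subset: "border x \<subseteq> E"
  unfolding border_def by (rule Collect_restrict)

text \<open>Otherwise the face of \<open>x\<close> would be the complement of a forest, up to finitely many points.\<close>

lemma not_forest_border:
  assumes "\<not> forest E" "x \<notin> pts E"
  shows "\<not> forest (border x)"
proof
  assume forest: "forest (border x)"
  define F where "F = connected_component_set (- pts E) x"
  \<comment> \<open>\<open>W\<close> is connected: a forest does not separate the plane, and
    deleting finitely many points from an open connected set leaves it connected.\<close>
  define W where "W = - pts (border x) - p ` \<Union>E"
  have "finite (\<Union>E)"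
    using finite_E card_edge by (intro finite_Union) (auto intro: card_ge_0_finite)
  moreover have "connected (- pts (border x))"
    using forest_same_face [OF forest border_subset]
    by (auto simp: connected_iff_connected_component)
  ultimately have "connected W"
    unfolding W_def using closed_pts [OF border_subset]
    by (intro connected_open_delete_finite) auto
  have verts: "p ` \<Union>E \<subseteq> pts E"
    using ends_in_edge by (fastforce simp: pts_def)
  have F_off: "F \<inter> pts E = {}"
    using connected_component_subset [of "- pts E" x] by (auto simp: F_def)
  have "F \<subseteq> W"
  proof -
    have "F \<inter> pts (border x) = {}" "F \<inter> p ` \<Union>E = {}"
      using F_off verts pts_mono [OF border_subset, of x] by fast+
    then show ?thesis unfolding W_def by fast
  qed
  have "open F"
    unfolding F_def by (intro open_connected_component open_Compl closed_pts order_refl)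
  have "frontier F \<subseteq> frontier (pts E)"
    unfolding F_def frontier_complement [of "pts E", symmetric]
    by (rule frontier_of_connected_component_subset)
  also have "\<dots> \<subseteq> pts E"
    by (intro frontier_subset_closed closed_pts) simp
  finally have frontier: "frontier F \<subseteq> pts E" .
  have "frontier F \<inter> W = {}"
  proof -
    \<comment> \<open>A frontier point of the face lies on some edge; unless it is an end of that
      edge, the edge belongs to the border.\<close>
    have "x \<in> pts (border x') \<union> p ` \<Union>E" if "x \<in> frontier F" "F = connected_component_set (- pts E) x'" for x x'
    proof -
      obtain e where e: "e \<in> E" "x \<in> path_image (\<gamma> e)"
        using frontier \<open>x \<in> frontier F\<close> by (auto simp: pts_def)
      show ?thesis
      proof (cases "x \<in> p ` e")
        case False
        then have "e \<in> border x'"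
          using e that by (auto simp: border_def open_edge_def)
        then show ?thesis using e by (auto simp: pts_def)
      qed (use e in auto)
    qed
    then show ?thesis using F_def by (auto simp: W_def)
  qed
  moreover have "x \<in> F" using assms(2) by (simp add: F_def)
  \<comment> \<open>The connected set \<open>W\<close> meets \<open>F\<close> but not its frontier,
    so it cannot leave \<open>F\<close>.\<close>
  ultimately have "W \<subseteq> F"
    using connected_Int_frontier [OF \<open>connected W\<close>, of F] \<open>F \<subseteq> W\<close> by blast
  \<comment> \<open>An edge outside the border would have an interior point in \<open>W\<close>,
    hence in the face, which no edge meets. So the border would be all of \<open>E\<close>, against
    the assumption that \<open>E\<close> is not a forest.\<close>
  have "e \<in> border x" if e: "e \<in> E" for e
  proof (rule ccontr)
    assume "e \<notin> border x"
    moreover obtain q where "q \<in> open_edge e" using open_edge_nonempty [OF e] by blast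
    ultimately have "q \<in> W"
      using open_edge_Int_pts [OF border_subset e, of x] open_edge_verts [OF e] by (auto simp: W_def)
    moreover have "q \<in> pts E"
      using \<open>q \<in> open_edge e\<close> e by (auto simp: pts_def open_edge_def)
    ultimately show False using \<open>W \<subseteq> F\<close> F_off by auto
  qed
  then have "border x = E" using border_subset by blast
  then show False using assms(1) forest by simp
qed

text \<open>Without \<open>e\<close>, all faces bordered by \<open>e\<close> lie in one face.
  Restoring \<open>e\<close> leaves at most one of them on each side of a Jordan curve through
  \<open>e\<close>, or only one in total if \<open>e\<close> is a bridge.\<close>

lemma card_border_faces:
  assumes e: "e \<in> E" and X: "finite X" "X \<inter> pts E = {}" "pairwise (\<lambda>x y. \<not> same_face E x y) X"
  shows "card {x \<in> X. e \<in> border x} \<le> 2"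
proof -
  obtain u v where uv: "e = {u, v}"
    using card_edge [OF e] by (auto simp: card_2_iff)
  define D where "D = E - {e}"
  have D: "D \<subseteq> E" "insert e D = E" "e \<notin> D"
    using e by (auto simp: D_def)
  define Y where "Y = {x \<in> X. e \<in> border x}"
  have "finite Y" using X(1) by (simp add: Y_def)
  obtain q where q: "q \<in> open_edge e" using open_edge_nonempty [OF e] by blast
  define F where "F = connected_component_set (- pts D) q"
  have "open F"
    unfolding F_def using closed_pts [OF D(1)] by (intro open_connected_component) auto
  have eF: "open_edge e \<subseteq> F"
    unfolding F_def using open_edge_Int_pts [OF D(1) e D(3)] q
    by (intro connected_component_maximal connected_open_edge e) auto
  have YF: "x \<in> F" if "x \<in> Y" for x
  proof -
    let ?C = "connected_component_set (- pts E) x"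
    \<comment> \<open>The frontier of the face of \<open>x\<close> meets \<open>F\<close>, which is
      open, so that face itself meets \<open>F\<close>.\<close>
    have "F \<inter> closure ?C \<noteq> {}"
      using that eF by (fastforce simp: Y_def border_def frontier_def)
    then obtain y where y: "y \<in> F" "y \<in> ?C"
      using open_Int_closure_eq_empty [OF \<open>open F\<close>] by blast
    have "same_face D x y"
      using y(2) pts_mono [OF D(1)] connected_component_of_subset [of "- pts E" x y "- pts D"] by auto
    then show ?thesis
      using y(1) connected_component_trans connected_component_sym unfolding F_def by fastforce
  qed
  have same: "same_face D x y" if "x \<in> Y" "y \<in> Y" for x y
    using YF [OF that(1)] YF [OF that(2)] connected_component_trans connected_component_sym
    unfolding F_def by fastforce
  have Y_off: "Y \<inter> pts E = {}" using X(2) by (auto simp: Y_def)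
  have Y_sep: "x = y" if "x \<in> Y" "y \<in> Y" "same_face E x y" for x y
    using X(3) that by (auto simp: Y_def pairwise_def)
  show ?thesis
  proof (cases "linked D u v")
    case True
    then obtain c where c: "simple_path c" "pathfinish c = pathstart c"
      "path_image (\<gamma> e) \<subseteq> path_image c" "path_image c \<subseteq> pts (insert e D)"
      "connected (pts D \<inter> path_image c)"
      using loop_of_linked [OF D(1), of u v] e D(3) unfolding uv by metis
    note J = Jordan_inside_outside [OF c(1,2)]
    \<comment> \<open>Two points on the same side of the curve are separated neither by
      \<open>D\<close> nor by the curve, hence not by \<open>E\<close>.\<close>
    have le1: "card (Y \<inter> S) \<le> 1" if S: "connected S" "S \<inter> path_image c = {}" for S
    proof -
      have "x = y" if "x \<in> Y \<inter> S" "y \<in> Y \<inter> S" for x y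
      proof (rule Y_sep)
        have "connected_component (- path_image c) x y"
          using that S by (auto simp: connected_component_def intro!: exI [of _ S])
        then show "same_face E x y"
          using same_face_insert_loop [OF D(1) c(1,3,4,5) same] that D(2) by auto
      qed (use that in auto)
      then show ?thesis
        using \<open>finite Y\<close> by (simp add: card_le_Suc0_iff_eq)
    qed
    have "Y \<subseteq> (Y \<inter> inside (path_image c)) \<union> (Y \<inter> outside (path_image c))"
      using J Y_off c(4) D(2) by blast
    then have "card Y \<le> card ((Y \<inter> inside (path_image c)) \<union> (Y \<inter> outside (path_image c)))"
      using \<open>finite Y\<close> by (intro card_mono) auto
    also have "\<dots> \<le> card (Y \<inter> inside (path_image c)) + card (Y \<inter> outside (path_image c))"
      by (rule card_Un_le)
    also have "\<dots> \<le> 1 + 1"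
      using J by (intro add_mono le1) auto
    finally show ?thesis by (simp add: Y_def)
  next
    case False
    have off: "x \<notin> path_image (\<gamma> e)" if "x \<in> Y" for x
      using Y_off that e by (auto simp: pts_def)
    have "x = y" if "x \<in> Y" "y \<in> Y" for x y
      using same_face_insert_bridge [OF D(1) _ False same [OF that]] e D(2) uv off that Y_sep
      by auto
    then have "card Y \<le> 1"
      using \<open>finite Y\<close> by (simp add: card_le_Suc0_iff_eq)
    then show ?thesis by (simp add: Y_def)
  qed
qed

theorem bipartite_card_bound:
  assumes bip: "\<And>e. e \<in> E \<Longrightarrow> \<exists>u v. u \<in> A \<and> v \<notin> A \<and> e = {u, v}"
    and V: "finite V" "\<Union>E \<subseteq> V" "card V \<ge> 3"
  shows "card E + 4 \<le> 2 * card V"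
proof (cases "forest E")
  case True
  \<comment> \<open>For a forest, \<open>card E \<le> card V - 1\<close>, and this is at most
    \<open>2 * card V - 4\<close> because \<open>card V \<ge> 3\<close>.\<close>
  then have "card E < card V" using forest_card_less V by fastforce
  then show ?thesis using V(3) by linarith
next
  case False
  obtain T where T: "T \<subseteq> E" "forest T" "\<And>u v. {u, v} \<in> E \<Longrightarrow> linked T u v"
    using spanning_forest_exists [OF finite_E card_edge] by metis
  have T_less: "card T < card V"
    using forest_card_less [OF T(2) V(1)] T(1) V by fastforce
  obtain X where X: "finite X" "X \<inter> pts E = {}" "pairwise (\<lambda>x y. \<not> same_face E x y) X"
    "card E < card X + card T"
    using separated_points_exist [OF T(2,1,3)] by metis
  \<comment> \<open>Incidences between the chosen points, one per face, and the edges bordering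
    these faces are counted twice: at least four for each point, at most two for each edge.\<close>
  have "4 * card X = (\<Sum>x\<in>X. 4)" by simp
  also have "\<dots> \<le> (\<Sum>x\<in>X. card (border x))"
  proof (rule sum_mono)
    fix x assume "x \<in> X"
    then have "\<not> forest (border x)" using not_forest_border [OF False] X(2) by auto
    then show "4 \<le> card (border x)"
      using border_subset [of x] finite_subset [OF border_subset finite_E] bip
      by (intro bipartite_not_forest_card_ge_4 [of _ A]) auto
  qed
  also have "\<dots> = (\<Sum>x\<in>X. \<Sum>e\<in>E. if e \<in> border x then 1 else 0)"
    using finite_E border_subset by (intro sum.cong) (simp_all flip: sum.inter_filter add: Int_absorb1 Collect_conj_eq)
  also have "\<dots> = (\<Sum>e\<in>E. card {x \<in> X. e \<in> border x})"
    by (subst sum.swap) (use X(1) in \<open>simp flip: sum.inter_filter\<close>)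
  also have "\<dots> \<le> (\<Sum>e\<in>E. 2)"
    by (intro sum_mono card_border_faces X)
  finally have "2 * card X \<le> card E" by simp
  then show ?thesis using X(4) T_less by linarith
qed

end

subsection \<open>Stacked straight-line drawings\<close>

lemma barycentric_unique:
  fixes A B C :: complex
  assumes nc: "\<not> collinear {A, B, C}"
    and eq: "a *\<^sub>R A + b *\<^sub>R B + c *\<^sub>R C = a' *\<^sub>R A + b' *\<^sub>R B + c' *\<^sub>R C"
    and sum: "a + b + c = 1" "a' + b' + c' = 1"
  shows "a = a'" "b = b'" "c = c'"
proof -
  have c: "c = 1 - a - b" "c' = 1 - a' - b'" using sum by auto
  have *: "(a - a') *\<^sub>R (A - C) + (b - b') *\<^sub>R (B - C) = 0"
    using eq unfolding c by (simp add: algebra_simps)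
  show a: "a = a'"
  proof (rule ccontr)
    assume "a \<noteq> a'"
    define k where "k = (b' - b) / (a - a')"
    have "A - C = (1 / (a - a')) *\<^sub>R ((a - a') *\<^sub>R (A - C))"
      using \<open>a \<noteq> a'\<close> by simp
    also have "(a - a') *\<^sub>R (A - C) = (b' - b) *\<^sub>R (B - C)"
      using * by (simp add: algebra_simps)
    finally have "A - C = k *\<^sub>R (B - C)" by (simp add: k_def)
    then have "A = k *\<^sub>R B + (1 - k) *\<^sub>R C" by (simp add: algebra_simps)
    then have "collinear {B, A, C}" unfolding collinear_3_expand by blast
    then show False using nc by (simp add: insert_commute)
  qed
  have "B \<noteq> C" using nc by (auto simp: insert_commute)
  then show b: "b = b'" using * a by simp
  show "c = c'" using c a b by simp
qed

context
  fixes A B C G :: complex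
  assumes nc: "\<not> collinear {A, B, C}"
    and G: "G = (1/3) *\<^sub>R A + (1/3) *\<^sub>R B + (1/3) *\<^sub>R C"
begin

lemma open_triangle: "interior (convex hull {A, B, C}) =
    {v. \<exists>a b c. 0 < a \<and> 0 < b \<and> 0 < c \<and> a + b + c = 1 \<and> a *\<^sub>R A + b *\<^sub>R B + c *\<^sub>R C = v}"
  by (rule interior_convex_hull_3_minimal [OF nc]) simp

lemma centroid_segment:
  assumes "v \<in> convex hull {G, A}"
  obtains t where "0 \<le> t" "t \<le> 1" "v = (1 - 2 * t) *\<^sub>R A + t *\<^sub>R B + t *\<^sub>R C" "t \<le> 1/3"
proof -
  obtain u where u: "0 \<le> u" "u \<le> 1" "v = (1 - u) *\<^sub>R G + u *\<^sub>R A"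
    using assms by (auto simp: segment_convex_hull [symmetric] in_segment)
  show thesis
    \<comment> \<open>The weight \<open>1 - u\<close> of the centroid is shared equally by the three
      corners.\<close>
    by (rule that [of "(1 - u) / 3"]) (use u in \<open>auto simp: G complex_eq_iff field_simps\<close>)
qed

lemma centroid_in_open_triangle: "G \<in> interior (convex hull {A, B, C})"
  unfolding open_triangle G by (intro CollectI exI [of _ "1/3"]) auto

lemma centroid_segment_subset: "convex hull {G, A} \<subseteq> insert A (interior (convex hull {A, B, C}))"
proof
  fix v assume "v \<in> convex hull {G, A}"
  then obtain t where t: "0 \<le> t" "v = (1 - 2 * t) *\<^sub>R A + t *\<^sub>R B + t *\<^sub>R C" "t \<le> 1/3"
    by (rule centroid_segment)
  show "v \<in> insert A (interior (convex hull {A, B, C}))"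
  proof (cases "t = 0")
    case False
    then show ?thesis unfolding open_triangle
      by (intro insertI2 CollectI exI [of _ "1 - 2 * t"] exI [of _ t]) (use t in auto)
  qed (use t in auto)
qed

lemma not_collinear_centroid: "\<not> collinear {G, A, B}"
proof
  assume "collinear {G, A, B}"
  then consider "G = B" | u where "A = u *\<^sub>R G + (1 - u) *\<^sub>R B"
    unfolding collinear_3_expand by blast
  then show False
  proof cases
    case 1
    then show False
      using barycentric_unique(1) [OF nc, of "1/3" "1/3" "1/3" 0 1 0] G by simp
  next
    case 2
    then have "1 *\<^sub>R A + 0 *\<^sub>R B + 0 *\<^sub>R C = (u/3) *\<^sub>R A + (1 - 2 * u / 3) *\<^sub>R B + (u/3) *\<^sub>R C"
      by (simp add: G complex_eq_iff field_simps)
    from barycentric_unique(1,3) [OF nc this] show False by simp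
  qed
qed

text \<open>In the part of the triangle at the side \<open>A B\<close>, the coordinate of
  \<open>C\<close> is strictly the smallest. The disjointness facts below reduce to such comparisons
  of coordinates.\<close>

lemma centroid_triangle:
  assumes "v \<in> interior (convex hull {G, A, B})"
  obtains a b c where "0 < c" "c < a" "c < b" "a + b + c = 1" "v = a *\<^sub>R A + b *\<^sub>R B + c *\<^sub>R C"
proof -
  obtain g a b where *: "0 < g" "0 < a" "0 < b" "g + a + b = 1" "g *\<^sub>R G + a *\<^sub>R A + b *\<^sub>R B = v"
    using assms interior_convex_hull_3_minimal [OF not_collinear_centroid] by auto
  show thesis
    by (rule that [of "g/3" "g/3 + a" "g/3 + b"]) (use * in \<open>auto simp: G algebra_simps\<close>)
qed

lemma centroid_triangle_subset:
  "interior (convex hull {G, A, B}) \<subseteq> interior (convex hull {A, B, C})"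
proof
  fix v assume "v \<in> interior (convex hull {G, A, B})"
  then obtain a b c where "0 < c" "c < a" "c < b" "a + b + c = 1" "v = a *\<^sub>R A + b *\<^sub>R B + c *\<^sub>R C"
    by (rule centroid_triangle)
  then show "v \<in> interior (convex hull {A, B, C})"
    unfolding open_triangle by (intro CollectI exI [of _ a] exI [of _ b] exI [of _ c]) auto
qed

lemma centroid_triangle_Int_segment: "interior (convex hull {G, A, B}) \<inter> convex hull {G, A} = {}"
proof (safe)
  fix v assume "v \<in> interior (convex hull {G, A, B})" "v \<in> convex hull {G, A}"
  then obtain a b c t where *: "0 < c" "c < a" "c < b" "a + b + c = 1"
      "a *\<^sub>R A + b *\<^sub>R B + c *\<^sub>R C = (1 - 2 * t) *\<^sub>R A + t *\<^sub>R B + t *\<^sub>R C"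
    by (metis centroid_triangle centroid_segment)
  from barycentric_unique(2,3) [OF nc *(5,4)] * show "v \<in> {}" by auto
qed

end

context
  fixes A B C G :: complex
  assumes nc: "\<not> collinear {A, B, C}"
    and G: "G = (1/3) *\<^sub>R A + (1/3) *\<^sub>R B + (1/3) *\<^sub>R C"
begin

text \<open>The facts of the preceding context single out one corner or side; with permuted
  hypotheses they apply to the others.\<close>

lemma nc_rotate: "\<not> collinear {B, C, A}" "\<not> collinear {C, A, B}" "\<not> collinear {B, A, C}"
  using nc by (simp_all add: insert_commute)

lemma centroid_rotate: "G = (1/3) *\<^sub>R B + (1/3) *\<^sub>R C + (1/3) *\<^sub>R A" "G = (1/3) *\<^sub>R C + (1/3) *\<^sub>R A + (1/3) *\<^sub>R B"
  "G = (1/3) *\<^sub>R B + (1/3) *\<^sub>R A + (1/3) *\<^sub>R C"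
  by (simp_all add: G)

lemma centroid_segments_Int: "convex hull {G, A} \<inter> convex hull {G, B} \<subseteq> {G}"
proof
  fix v assume "v \<in> convex hull {G, A} \<inter> convex hull {G, B}"
  then obtain t s where *: "v = (1 - 2 * t) *\<^sub>R A + t *\<^sub>R B + t *\<^sub>R C" "v = (1 - 2 * s) *\<^sub>R B + s *\<^sub>R C + s *\<^sub>R A"
    by (metis IntD1 IntD2 centroid_segment [OF nc G] centroid_segment [OF nc_rotate(1) centroid_rotate(1)])
  then have "(1 - 2 * t) *\<^sub>R A + t *\<^sub>R B + t *\<^sub>R C = s *\<^sub>R A + (1 - 2 * s) *\<^sub>R B + s *\<^sub>R C"
    by (simp add: add_ac)
  from barycentric_unique [OF nc this] have "t = 1/3" by auto
  then show "v \<in> {G}" using *(1) G by (simp only: singleton_iff) simp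
qed

lemma centroid_triangle_Int_opposite: "interior (convex hull {G, A, B}) \<inter> convex hull {G, C} = {}"
proof (safe)
  fix v assume "v \<in> interior (convex hull {G, A, B})" "v \<in> convex hull {G, C}"
  then obtain a b c t where *: "0 < c" "c < a" "c < b" "a + b + c = 1"
      "a *\<^sub>R A + b *\<^sub>R B + c *\<^sub>R C = (1 - 2 * t) *\<^sub>R C + t *\<^sub>R A + t *\<^sub>R B" "t \<le> 1/3"
    by (metis centroid_triangle [OF nc G] centroid_segment [OF nc_rotate(2) centroid_rotate(2)])
  from *(5) have "a *\<^sub>R A + b *\<^sub>R B + c *\<^sub>R C = t *\<^sub>R A + t *\<^sub>R B + (1 - 2 * t) *\<^sub>R C"
    by (simp add: add_ac)
  from barycentric_unique [OF nc this *(4)] * show "v \<in> {}" by auto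
qed

lemma centroid_triangle_Int_segments:
  assumes "S \<in> {A, B, C}"
  shows "interior (convex hull {G, A, B}) \<inter> convex hull {G, S} = {}"
proof -
  have "interior (convex hull {G, A, B}) \<inter> convex hull {G, B} = {}"
    using centroid_triangle_Int_segment [OF nc_rotate(3) centroid_rotate(3)] by (simp add: insert_commute)
  then show ?thesis
    using assms centroid_triangle_Int_segment [OF nc G] centroid_triangle_Int_opposite by blast
qed

text \<open>A common point would have \<open>c < a\<close> from the first triangle and
  \<open>a < c\<close> from the second.\<close>

lemma centroid_triangles_Int:
  "interior (convex hull {G, A, B}) \<inter> interior (convex hull {G, B, C}) = {}"
proof (safe)
  fix v assume "v \<in> interior (convex hull {G, A, B})" "v \<in> interior (convex hull {G, B, C})"
  then obtain a b c a' b' c' where *: "0 < c" "c < a" "c < b" "a + b + c = 1"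
      "v = a *\<^sub>R A + b *\<^sub>R B + c *\<^sub>R C"
      "0 < a'" "a' < b'" "a' < c'" "b' + c' + a' = 1" "v = b' *\<^sub>R B + c' *\<^sub>R C + a' *\<^sub>R A"
    by (metis centroid_triangle [OF nc G] centroid_triangle [OF nc_rotate(1) centroid_rotate(1)])
  then have "a *\<^sub>R A + b *\<^sub>R B + c *\<^sub>R C = a' *\<^sub>R A + b' *\<^sub>R B + c' *\<^sub>R C" "a' + b' + c' = 1"
    by (simp_all add: add_ac)
  from barycentric_unique [OF nc this(1) *(4) this(2)] * show "v \<in> {}" by auto
qed

end

section \<open>Straight-line drawings with empty triangles\<close>

definition face :: "('a \<Rightarrow> complex) \<Rightarrow> 'a \<times> 'a \<times> 'a \<Rightarrow> complex set" where
  "face p = (\<lambda>(x, y, z). interior (convex hull {p x, p y, p z}))"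

text \<open>\<open>F\<close> lists triangles that are still empty and so available for insertions.
  It need not contain every face, and the unbounded region is never listed.\<close>

definition straight :: "('a \<Rightarrow> complex) \<Rightarrow> 'a set \<Rightarrow> 'a set set \<Rightarrow> ('a \<times> 'a \<times> 'a) set \<Rightarrow> bool" where
  "straight p V E F \<longleftrightarrow> inj_on p V \<and>
     (\<forall>e\<in>E. e \<subseteq> V \<and> card e = 2 \<and> convex hull (p ` e) \<inter> p ` V \<subseteq> p ` e) \<and>
     (\<forall>e\<in>E. \<forall>f\<in>E. e \<noteq> f \<longrightarrow> convex hull (p ` e) \<inter> convex hull (p ` f) \<subseteq> p ` (e \<inter> f)) \<and>
     (\<forall>(x, y, z)\<in>F. {x, y, z} \<subseteq> V \<and> \<not> collinear {p x, p y, p z}) \<and>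
     (\<forall>t\<in>F. face p t \<inter> p ` V = {} \<and> (\<forall>e\<in>E. face p t \<inter> convex hull (p ` e) = {})) \<and>
     (\<forall>t\<in>F. \<forall>t'\<in>F. t \<noteq> t' \<longrightarrow> face p t \<inter> face p t' = {})"

context
  fixes p :: "'a \<Rightarrow> complex" and V E F
  assumes S: "straight p V E F"
begin

lemma straight_inj: "inj_on p V"
  using S by (simp add: straight_def)

lemma straight_edge:
  assumes "e \<in> E"
  shows "e \<subseteq> V" "card e = 2" "convex hull (p ` e) \<inter> p ` V \<subseteq> p ` e"
  using S assms by (simp_all add: straight_def)

lemma straight_edges:
  assumes "e \<in> E" "f \<in> E" "e \<noteq> f"
  shows "convex hull (p ` e) \<inter> convex hull (p ` f) \<subseteq> p ` (e \<inter> f)"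
  using S assms by (simp add: straight_def)

lemma straight_face:
  assumes "(x, y, z) \<in> F"
  shows "{x, y, z} \<subseteq> V" "\<not> collinear {p x, p y, p z}"
  using S assms by (auto simp: straight_def)

lemma straight_face_verts: "t \<in> F \<Longrightarrow> face p t \<inter> p ` V = {}"
  using S by (simp add: straight_def)

lemma straight_face_edge: "t \<in> F \<Longrightarrow> e \<in> E \<Longrightarrow> face p t \<inter> convex hull (p ` e) = {}"
  using S by (simp add: straight_def)

lemma straight_faces: "t \<in> F \<Longrightarrow> t' \<in> F \<Longrightarrow> t \<noteq> t' \<Longrightarrow> face p t \<inter> face p t' = {}"
  using S by (simp add: straight_def)

end

text \<open>The three new segments and the three new open triangles stay inside the old open
  triangle, apart from the corners. As that triangle was empty, they can meet the old drawing only
  in these corners.\<close>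

lemma straight_stack:
  assumes S: "straight p V E F" and xyz: "(x, y, z) \<in> F" and w: "w \<notin> V"
  defines "p' \<equiv> p(w := (1/3) *\<^sub>R p x + (1/3) *\<^sub>R p y + (1/3) *\<^sub>R p z)"
  shows "straight p' (insert w V) ({{w, x}, {w, y}, {w, z}} \<union> E)
    ({(w, y, z), (x, w, z), (x, y, w)} \<union> (F - {(x, y, z)}))"
proof -
  define G where "G = p' w"
  let ?T = "interior (convex hull {p x, p y, p z})"
  have V: "x \<in> V" "y \<in> V" "z \<in> V" and nc: "\<not> collinear {p x, p y, p z}"
    using S xyz by (auto simp: straight_def)
  have G: "G = (1/3) *\<^sub>R p x + (1/3) *\<^sub>R p y + (1/3) *\<^sub>R p z"
    by (simp add: G_def p'_def)
  have p'_V: "p' v = p v" if "v \<in> V" for v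
    using that w by (auto simp: p'_def)
  have p'_w: "p' w = G" by (simp add: G_def)
  have p'_sub: "p' ` e = p ` e" if "e \<subseteq> V" for e
    using that p'_V by (force simp: image_iff)
  note inj = straight_inj [OF S] and edge = straight_edge [OF S] and edges = straight_edges [OF S]
    and face_V = straight_face_verts [OF S] and face_E = straight_face_edge [OF S]
    and faces = straight_faces [OF S] and F_V = straight_face [OF S]
  have T: "face p (x, y, z) = ?T" by (simp add: face_def)
  note TV = face_V [OF xyz, unfolded T] and TE = face_E [OF xyz, unfolded T]
  \<comment> \<open>\<open>rot(1,4)\<close> and \<open>rot(2,5)\<close> transfer a fact to the
    triangle rotated by one and by two corners.\<close>
  note rot = nc_rotate [OF nc G] centroid_rotate [OF nc G]
  have GT: "G \<in> ?T" by (rule centroid_in_open_triangle [OF nc G])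
  have G_notin: "G \<notin> p ` V" using GT TV by auto
  have seg: "convex hull {G, p s} \<subseteq> insert (p s) ?T" if "s \<in> {x, y, z}" for s
    using that centroid_segment_subset [OF nc G] centroid_segment_subset [OF rot(1,4)]
      centroid_segment_subset [OF rot(2,5)] by (auto simp: insert_commute)
  have segs: "convex hull {G, p s} \<inter> convex hull {G, p t} \<subseteq> {G}"
    if "s \<in> {x, y, z}" "t \<in> {x, y, z}" "s \<noteq> t" for s t
    using that centroid_segments_Int [OF nc G] centroid_segments_Int [OF rot(1,4)]
      centroid_segments_Int [OF rot(2,5)] by (auto simp: Int_commute)
  let ?N = "{{w, x}, {w, y}, {w, z}}"
  have N: "\<exists>s\<in>{x, y, z}. e = {w, s}" if "e \<in> ?N" for e
    using that by auto
  have img: "p' ` {w, s} = {G, p s}" if "s \<in> {x, y, z}" for s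
    using that V p'_V p'_w by auto
  have new_V: "convex hull {G, p s} \<inter> p ` V \<subseteq> {p s}" if "s \<in> {x, y, z}" for s
    using seg [OF that] TV by auto
  have new_E: "convex hull (p ` e) \<inter> convex hull {G, p s} \<subseteq> p ` (e \<inter> {w, s})"
    if "s \<in> {x, y, z}" "e \<in> E" for e s
  proof -
    have "convex hull (p ` e) \<inter> convex hull {G, p s} \<subseteq> convex hull (p ` e) \<inter> {p s}"
      using seg [OF that(1)] TE [OF that(2)] by auto
    also have "\<dots> \<subseteq> p ` e \<inter> {p s}"
      using edge(3) [OF that(2)] V that(1) by auto
    also have "\<dots> \<subseteq> p ` (e \<inter> {w, s})"
    proof
      fix v assume v: "v \<in> p ` e \<inter> {p s}"
      have "s \<in> V" using V that(1) by auto
      then have "p s \<in> p ` e \<longleftrightarrow> s \<in> e"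
        by (rule inj_on_image_mem_iff [OF inj _ edge(1) [OF that(2)]])
      moreover have "v = p s" using v by simp
      ultimately have "v = p s" "s \<in> e \<inter> {w, s}" using IntD1 [OF v] by (simp_all only: Int_iff) simp_all
      then show "v \<in> p ` (e \<inter> {w, s})" by (rule image_eqI)
    qed
    finally show ?thesis .
  qed
  let ?M = "{(w, y, z), (x, w, z), (x, y, w)}"
  have face': "face p' t = face p t" if "t \<in> F" for t
    using F_V that p'_V by (cases t) (auto simp: face_def)
  have M_face: "face p' (w, y, z) = interior (convex hull {G, p y, p z})"
    "face p' (x, w, z) = interior (convex hull {G, p z, p x})"
    "face p' (x, y, w) = interior (convex hull {G, p x, p y})"
    using V p'_V p'_w by (simp_all add: face_def insert_commute)
  have M_sub: "face p' t \<subseteq> ?T" if "t \<in> ?M" for t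
    using that centroid_triangle_subset [OF nc G] centroid_triangle_subset [OF rot(1,4)]
      centroid_triangle_subset [OF rot(2,5)] by (auto simp: M_face insert_commute)
  have M_seg: "face p' t \<inter> convex hull {G, p s} = {}" if "t \<in> ?M" "s \<in> {x, y, z}" for t s
  proof -
    have "p s \<in> {p x, p y, p z}" using that(2) by blast
    then show ?thesis
      using that(1) centroid_triangle_Int_segments [OF nc G, of "p s"]
        centroid_triangle_Int_segments [OF rot(1,4), of "p s"]
        centroid_triangle_Int_segments [OF rot(2,5), of "p s"] by (auto simp: M_face simp del: Int_iff)
  qed
  have M_faces: "face p' t \<inter> face p' t' = {}" if "t \<in> ?M" "t' \<in> ?M" "t \<noteq> t'" for t t'
    using that centroid_triangles_Int [OF nc G] centroid_triangles_Int [OF rot(1,4)]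
      centroid_triangles_Int [OF rot(2,5)] by (auto simp: M_face Int_commute)
  have p'_insert: "p' ` insert w V = insert G (p ` V)"
    by (simp add: p'_w p'_sub)
  show ?thesis
    unfolding straight_def
  proof (intro conjI ballI impI)
    show "inj_on p' (insert w V)"
      using inj w G_notin p'_V by (simp add: p'_w p'_sub cong: inj_on_cong)
  next
    fix e assume "e \<in> ?N \<union> E"
    then consider s where "s \<in> {x, y, z}" "e = {w, s}" | "e \<in> E" using N by blast
    then have "e \<subseteq> insert w V \<and> card e = 2 \<and> convex hull (p' ` e) \<inter> p' ` insert w V \<subseteq> p' ` e"
    proof cases
      case 1
      have "e \<subseteq> insert w V" "card e = 2" using 1 V w by (auto simp: card_insert_if)
      moreover have "convex hull (p' ` e) \<inter> p' ` insert w V \<subseteq> p' ` e"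
        unfolding 1(2) img [OF 1(1)] p'_insert using new_V [OF 1(1)] by blast
      ultimately show ?thesis by simp
    next
      case 2
      have "e \<subseteq> insert w V" "card e = 2" using edge(1,2) [OF 2] by auto
      moreover have "convex hull (p' ` e) \<inter> p' ` insert w V \<subseteq> p' ` e"
        unfolding p'_sub [OF edge(1) [OF 2]] p'_insert using edge(3) [OF 2] TE [OF 2] GT by blast
      ultimately show ?thesis by simp
    qed
    then show "e \<subseteq> insert w V" "card e = 2" "convex hull (p' ` e) \<inter> p' ` insert w V \<subseteq> p' ` e"
      by simp_all
  next
    fix e f assume "e \<in> ?N \<union> E" "f \<in> ?N \<union> E" "e \<noteq> f"
    then consider s t where "s \<in> {x, y, z}" "e = {w, s}" "t \<in> {x, y, z}" "f = {w, t}" "s \<noteq> t"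
      | s where "s \<in> {x, y, z}" "e = {w, s}" "f \<in> E"
      | s where "s \<in> {x, y, z}" "f = {w, s}" "e \<in> E" | "e \<in> E" "f \<in> E" using N by blast
    then show "convex hull (p' ` e) \<inter> convex hull (p' ` f) \<subseteq> p' ` (e \<inter> f)"
    proof cases
      case 1
      have "G \<in> p' ` ({w, s} \<inter> {w, t})" using p'_w by auto
      then show ?thesis
        unfolding 1(2,4) img [OF 1(1)] img [OF 1(3)] using segs [OF 1(1,3,5)] by blast
    next
      case 2
      then have "p' ` (e \<inter> f) = p ` (e \<inter> f)" using w edge(1) by (intro p'_sub) blast
      then show ?thesis
        using new_E [OF 2(1,3)] unfolding 2(2) img [OF 2(1)] p'_sub [OF edge(1) [OF 2(3)]]
        by (simp add: Int_commute)
    next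
      case 3
      then have "p' ` (e \<inter> f) = p ` (e \<inter> f)" using w edge(1) by (intro p'_sub) blast
      then show ?thesis
        using new_E [OF 3(1,3)] unfolding 3(2) img [OF 3(1)] p'_sub [OF edge(1) [OF 3(3)]] by simp
    next
      case 4
      then have "p' ` (e \<inter> f) = p ` (e \<inter> f)" using edge(1) by (intro p'_sub) blast
      then show ?thesis
        using edges [OF 4 \<open>e \<noteq> f\<close>] p'_sub [OF edge(1) [OF 4(1)]] p'_sub [OF edge(1) [OF 4(2)]] by simp
    qed
  next
    fix t assume "t \<in> ?M \<union> (F - {(x, y, z)})"
    then show "case t of (a, b, c) \<Rightarrow> {a, b, c} \<subseteq> insert w V \<and> \<not> collinear {p' a, p' b, p' c}"
      using not_collinear_centroid [OF nc G] not_collinear_centroid [OF rot(1,4)]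
        not_collinear_centroid [OF rot(2,5)] V p'_V p'_w F_V by (auto simp: insert_commute)
  next
    fix t assume t: "t \<in> ?M \<union> (F - {(x, y, z)})"
    show "face p' t \<inter> p' ` insert w V = {}"
    proof (cases "t \<in> ?M")
      case True
      have "G \<in> convex hull {G, p x}" by (simp add: hull_inc)
      then show ?thesis
        unfolding p'_insert using M_sub [OF True] M_seg [OF True, of x] TV by blast
    next
      case False
      then have "t \<in> F" "t \<noteq> (x, y, z)" using t by auto
      then show ?thesis
        unfolding p'_insert face' [OF \<open>t \<in> F\<close>]
        using face_V [of t] faces [of t "(x, y, z)"] xyz GT unfolding T by blast
    qed
    fix e assume "e \<in> ?N \<union> E"
    then consider s where "s \<in> {x, y, z}" "e = {w, s}" | "e \<in> E" using N by blast
    then show "face p' t \<inter> convex hull (p' ` e) = {}"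
    proof cases
      case 1
      show ?thesis
      proof (cases "t \<in> ?M")
        case False
        then have "t \<in> F" "t \<noteq> (x, y, z)" using t by auto
        then have "face p' t \<inter> insert (p s) ?T = {}"
          unfolding face' [OF \<open>t \<in> F\<close>]
          using face_V [of t] faces [of t "(x, y, z)"] xyz V 1(1) unfolding T by blast
        then show ?thesis unfolding 1(2) img [OF 1(1)] using seg [OF 1(1)] by blast
      qed (use M_seg 1 img in auto)
    next
      case 2
      show ?thesis
      proof (cases "t \<in> ?M")
        case True
        then show ?thesis unfolding p'_sub [OF edge(1) [OF 2]] using M_sub TE [OF 2] by blast
      next
        case False
        then have "t \<in> F" using t by blast
        then show ?thesis unfolding p'_sub [OF edge(1) [OF 2]] face' [OF \<open>t \<in> F\<close>]
          by (rule face_E [OF _ 2])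
      qed
    qed
  next
    fix t t' assume t: "t \<in> ?M \<union> (F - {(x, y, z)})" "t' \<in> ?M \<union> (F - {(x, y, z)})" "t \<noteq> t'"
    have old: "face p' u \<inter> ?T = {}" if "u \<in> F - {(x, y, z)}" for u
      using that face' [of u] faces [of u "(x, y, z)"] xyz unfolding T by blast
    show "face p' t \<inter> face p' t' = {}"
    proof (cases "t \<in> ?M"; cases "t' \<in> ?M")
      assume "t \<in> ?M" "t' \<in> ?M"
      then show ?thesis using M_faces t(3) by blast
    next
      assume "t \<in> ?M" "t' \<notin> ?M"
      then show ?thesis using M_sub [of t] old [of t'] t(2) by blast
    next
      assume "t \<notin> ?M" "t' \<in> ?M"
      then show ?thesis using M_sub [of t'] old [of t] t(1) by blast
    next
      assume "t \<notin> ?M" "t' \<notin> ?M"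
      then have "t \<in> F" "t' \<in> F" using t by blast+
      then show ?thesis using faces [OF _ _ t(3)] face' by simp
    qed
  qed
qed

definition stacked :: "'a set \<Rightarrow> 'a set set \<Rightarrow> ('a \<times> 'a \<times> 'a) set \<Rightarrow> bool" where
  "stacked V E F \<longleftrightarrow> (\<exists>p. straight p V E F)"

lemma stacked_edge: "stacked V E F \<Longrightarrow> e \<in> E \<Longrightarrow> e \<subseteq> V"
  unfolding stacked_def by (elim exE) (rule straight_edge(1))

lemma stacked_face: "stacked V E F \<Longrightarrow> (x, y, z) \<in> F \<Longrightarrow> {x, y, z} \<subseteq> V"
  unfolding stacked_def by (elim exE) (rule straight_face(1))

lemma stacked_subset:
  assumes "stacked V E F" "V' \<subseteq> V" "E' \<subseteq> E" "F' \<subseteq> F"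
    and "\<And>e. e \<in> E' \<Longrightarrow> e \<subseteq> V'" "\<And>x y z. (x, y, z) \<in> F' \<Longrightarrow> {x, y, z} \<subseteq> V'"
  shows "stacked V' E' F'"
proof -
  obtain p where p: "straight p V E F" using assms(1) by (auto simp: stacked_def)
  have "straight p V' E' F'"
    unfolding straight_def
  proof (intro conjI ballI impI)
    show "inj_on p V'" using straight_inj [OF p] assms(2) by (rule inj_on_subset)
  next
    fix e assume e: "e \<in> E'"
    then show "e \<subseteq> V'" by (rule assms(5))
    note edge = straight_edge [OF p subsetD [OF assms(3) e]]
    show "card e = 2" by (rule edge)
    show "convex hull (p ` e) \<inter> p ` V' \<subseteq> p ` e"
      using edge(3) assms(2) by fast
  next
    fix e f assume "e \<in> E'" "f \<in> E'" "e \<noteq> f"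
    then show "convex hull (p ` e) \<inter> convex hull (p ` f) \<subseteq> p ` (e \<inter> f)"
      by (intro straight_edges [OF p] subsetD [OF assms(3)])
  next
    fix t assume t: "t \<in> F'"
    then have tF: "t \<in> F" using assms(4) by auto
    show "case t of (x, y, z) \<Rightarrow> {x, y, z} \<subseteq> V' \<and> \<not> collinear {p x, p y, p z}"
      using straight_face [OF p] assms(6) t tF by (cases t) auto
    show "face p t \<inter> p ` V' = {}"
      using straight_face_verts [OF p tF] assms(2) by fast
    fix e assume "e \<in> E'"
    then show "face p t \<inter> convex hull (p ` e) = {}"
      by (intro straight_face_edge [OF p tF] subsetD [OF assms(3)])
  next
    fix t t' assume "t \<in> F'" "t' \<in> F'" "t \<noteq> t'"
    then show "face p t \<inter> face p t' = {}"
      by (intro straight_faces [OF p] subsetD [OF assms(4)])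
  qed
  then show ?thesis by (auto simp: stacked_def)
qed

text \<open>Faces are ordered triples, but the open triangle depends only on the set of
  corners.\<close>

lemma stacked_reorder:
  assumes S: "stacked V E F" and t: "(a, b, c) \<in> F" "{a, b, c} = {x, y, z}"
  shows "stacked V E (insert (x, y, z) (F - {(a, b, c)}))"
proof -
  obtain p where p: "straight p V E F" using S by (auto simp: stacked_def)
  have im: "{p x, p y, p z} = {p a, p b, p c}"
    using arg_cong [OF t(2), of "image p"] by simp
  have face: "face p (x, y, z) = face p (a, b, c)"
    by (simp add: face_def im)
  have "straight p V E (insert (x, y, z) (F - {(a, b, c)}))"
    unfolding straight_def
  proof (intro conjI ballI impI)
    fix s assume s: "s \<in> insert (x, y, z) (F - {(a, b, c)})"
    then consider "s = (x, y, z)" | "s \<in> F" by blast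
    then have "(case s of (x, y, z) \<Rightarrow> {x, y, z} \<subseteq> V \<and> \<not> collinear {p x, p y, p z}) \<and>
      (\<exists>s'\<in>F. face p s = face p s')"
    proof cases
      case 1
      have "\<not> collinear {p x, p y, p z}" "{x, y, z} \<subseteq> V"
        using straight_face [OF p t(1)] im t(2) by simp_all
      then show ?thesis unfolding 1 using t(1) face by blast
    next
      case 2
      then show ?thesis using straight_face [OF p] by (cases s) auto
    qed
    then obtain s' where s': "case s of (x, y, z) \<Rightarrow> {x, y, z} \<subseteq> V \<and> \<not> collinear {p x, p y, p z}"
      "s' \<in> F" "face p s = face p s'" by blast
    show "case s of (x, y, z) \<Rightarrow> {x, y, z} \<subseteq> V \<and> \<not> collinear {p x, p y, p z}"
      by (rule s')
    show "face p s \<inter> p ` V = {}"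
      unfolding s'(3) by (rule straight_face_verts [OF p s'(2)])
    show "face p s \<inter> convex hull (p ` e) = {}" if "e \<in> E" for e
      unfolding s'(3) by (rule straight_face_edge [OF p s'(2) that])
  next
    fix s s' assume s: "s \<in> insert (x, y, z) (F - {(a, b, c)})"
      "s' \<in> insert (x, y, z) (F - {(a, b, c)})" "s \<noteq> s'"
    have old: "face p u \<inter> face p (a, b, c) = {}" if "u \<in> F - {(a, b, c)}" for u
      using that by (intro straight_faces [OF p _ t(1)]) auto
    consider "s = (x, y, z)" "s' \<in> F - {(a, b, c)}" | "s' = (x, y, z)" "s \<in> F - {(a, b, c)}"
      | "s \<in> F" "s' \<in> F"
      using s by blast
    then show "face p s \<inter> face p s' = {}"
    proof cases
      case 1
      then show ?thesis using old [of s'] by (simp add: face Int_commute)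
    next
      case 2
      then show ?thesis using old [of s] by (simp add: face)
    next
      case 3
      then show ?thesis using s(3) by (intro straight_faces [OF p])
    qed
  next
    show "inj_on p V" by (rule straight_inj [OF p])
  next
    fix e assume "e \<in> E"
    then show "e \<subseteq> V" "card e = 2" "convex hull (p ` e) \<inter> p ` V \<subseteq> p ` e"
      by (rule straight_edge [OF p])+
  next
    fix e f assume "e \<in> E" "f \<in> E" "e \<noteq> f"
    then show "convex hull (p ` e) \<inter> convex hull (p ` f) \<subseteq> p ` (e \<inter> f)"
      by (rule straight_edges [OF p])
  qed
  then show ?thesis by (auto simp: stacked_def)
qed

lemma stacked_insert:
  assumes "stacked V E F" "(x, y, z) \<in> F" "w \<notin> V"
  shows "stacked (insert w V) ({{w, x}, {w, y}, {w, z}} \<union> E)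
    ({(w, y, z), (x, w, z), (x, y, w)} \<union> (F - {(x, y, z)}))"
proof -
  obtain p where "straight p V E F" using assms(1) by (auto simp: stacked_def)
  from straight_stack [OF this assms(2,3)] show ?thesis unfolding stacked_def by (intro exI)
qed

text \<open>The outer triangle is obtained by three insertions into an auxiliary one without edges.\<close>

lemma stacked_triangle:
  fixes x y z :: 'a
  assumes inf: "infinite (UNIV :: 'a set)" and dist: "x \<noteq> y" "y \<noteq> z" "x \<noteq> z"
  shows "stacked {x, y, z} {{x, y}, {y, z}, {x, z}} {(x, y, z)}"
proof -
  have new: "\<exists>v. v \<notin> S" if "finite S" for S :: "'a set"
    using ex_new_if_finite [OF inf that] .
  obtain a where a: "a \<notin> {x, y, z}" using new [of "{x, y, z}"] by auto
  obtain b where b: "b \<notin> {a, x, y, z}" using new [of "{a, x, y, z}"] by auto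
  obtain c where c: "c \<notin> {a, b, x, y, z}" using new [of "{a, b, x, y, z}"] by auto
  \<comment> \<open>Drawn without edges, the auxiliary triangle leaves only its empty face to check;
    the edges among \<open>x\<close>, \<open>y\<close>, \<open>z\<close> then come from
    \<open>stacked_insert\<close>. The default \<open>\<i>\<close> is the position of
    \<open>c\<close>.\<close>
  define p where "p = (\<lambda>v. if v = a then 0 else if v = b then 1 else \<i>)"
  have "\<not> collinear {0, 1, \<i>}"
  proof
    assume "collinear {0, 1, \<i>}"
    then obtain u where "1 = u *\<^sub>R 0 + (1 - u) *\<^sub>R \<i>"
      unfolding collinear_3_expand by (auto simp: complex_eq_iff)
    then show False by (simp add: complex_eq_iff)
  qed
  then have "straight p {a, b, c} {} {(a, b, c)}"
    using b c not_in_interior_convex_hull_3 [where a = 0 and b = 1 and c = \<i>]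
    by (auto simp: straight_def face_def p_def inj_on_def complex_eq_iff)
  then have "stacked {a, b, c} {} {(a, b, c)}" by (auto simp: stacked_def)
  from stacked_insert [OF this, of a b c x] a b c
  have "stacked {x, a, b, c} {{x, a}, {x, b}, {x, c}} {(x, b, c), (a, x, c), (a, b, x)}"
    by auto
  then have "stacked {x, a, b, c} {} {(x, b, c)}"
    by (rule stacked_subset) auto
  from stacked_insert [OF this, of x b c y] a b c dist
  have "stacked {y, x, a, b, c} {{y, x}, {y, b}, {y, c}} {(y, b, c), (x, y, c), (x, b, y)}"
    by (simp add: insert_Diff_if) argo
  then have "stacked {y, x, a, b, c} {{y, x}} {(x, y, c)}"
    by (rule stacked_subset) auto
  from stacked_insert [OF this, of x y c z] a b c dist
  have "stacked {z, y, x, a, b, c} {{y, x}, {z, x}, {z, y}, {z, c}} {(z, y, c), (x, z, c), (x, y, z)}"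
    by (simp add: insert_Diff_if) argo
  then show ?thesis
    by (rule stacked_subset) auto
qed

text \<open>A path with two poles: every vertex of the list is joined to \<open>x\<close>, to
  \<open>y\<close> and to its predecessor, where \<open>z\<close> precedes the first one.\<close>

fun fan :: "'a \<Rightarrow> 'a \<Rightarrow> 'a \<Rightarrow> 'a list \<Rightarrow> 'a set set" where
  "fan x y z [] = {}"
| "fan x y z (w # ws) = {{w, x}, {w, y}, {w, z}} \<union> fan x y w ws"

lemma fan_left: "w \<in> set ws \<Longrightarrow> {w, x} \<in> fan x y z ws"
  by (induction ws arbitrary: z) auto

lemma fan_right: "w \<in> set ws \<Longrightarrow> {w, y} \<in> fan x y z ws"
  by (induction ws arbitrary: z) auto

lemma fan_consecutive: "{w, w'} \<in> fan x y z (us @ w # w' # ws)"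
  by (induction us arbitrary: z) (simp_all add: insert_commute [of w w'])

text \<open>Each vertex of the list goes into the face spanned by the poles \<open>x\<close>,
  \<open>y\<close> and the previous vertex, so a single face accommodates the whole list.\<close>

lemma stacked_fan:
  assumes "stacked V E F" "(a, b, c) \<in> F" "{a, b, c} = {x, y, z}"
    and "distinct ws" "set ws \<inter> V = {}"
  shows "stacked (V \<union> set ws) (E \<union> fan x y z ws) (F - {(a, b, c)})"
proof -
  have "stacked (V \<union> set ws) (E \<union> fan x y z ws) F"
    if "stacked V E (insert (x, y, z) F)" "(x, y, z) \<notin> F" "distinct ws" "set ws \<inter> V = {}" for V E F
    using that
  proof (induction ws arbitrary: V E z F)
    case Nil
    then show ?case
      using stacked_face [OF Nil.prems(1)] stacked_edge [OF Nil.prems(1)]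
      by simp (rule stacked_subset [OF Nil.prems(1)]; blast)
  next
    case (Cons w ws)
    have w: "w \<notin> V" using Cons.prems by auto
    note new = stacked_insert [OF Cons.prems(1) insertI1 w]
    have notin: "(x, y, w) \<notin> F"
      using stacked_face [OF Cons.prems(1), of x y w] w by auto
    have "stacked (insert w V) ({{w, x}, {w, y}, {w, z}} \<union> E) (insert (x, y, w) F)"
    proof (rule stacked_subset [OF new])
      show "insert (x, y, w) F \<subseteq>
          {(w, y, z), (x, w, z), (x, y, w)} \<union> (insert (x, y, z) F - {(x, y, z)})"
        using Cons.prems(2) by auto
      show "{a, b, c} \<subseteq> insert w V" if "(a, b, c) \<in> insert (x, y, w) F" for a b c
        using that stacked_face [OF Cons.prems(1)] by blast
    qed (use stacked_edge [OF new] in auto)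
    from Cons.IH [OF this notin] Cons.prems
    have "stacked (insert w V \<union> set ws) ({{w, x}, {w, y}, {w, z}} \<union> E \<union> fan x y w ws) F" by auto
    moreover have "insert w V \<union> set ws = V \<union> set (w # ws)" by auto
    moreover have "{{w, x}, {w, y}, {w, z}} \<union> E \<union> fan x y w ws = E \<union> fan x y z (w # ws)" by auto
    ultimately show ?case by metis
  qed
  note fan = this
  show ?thesis
  proof (cases "(x, y, z) \<in> F - {(a, b, c)}")
    case True
    \<comment> \<open>Two different triples in \<open>F\<close> with the same corners would be the
      same nonempty open triangle, although faces in \<open>F\<close> are disjoint.\<close>
    obtain p where p: "straight p V E F" using assms(1) by (auto simp: stacked_def)
    have "face p (x, y, z) = face p (a, b, c)"
      using arg_cong [OF assms(3), of "image p"] by (simp add: face_def)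
    moreover have "face p (x, y, z) \<inter> face p (a, b, c) = {}"
      using straight_faces [OF p] True assms(2) by blast
    moreover have "face p (a, b, c) \<noteq> {}"
      using centroid_in_open_triangle [OF straight_face(2) [OF p assms(2)] refl] by (auto simp: face_def)
    ultimately show ?thesis by simp
  next
    case False
    with fan [OF stacked_reorder [OF assms(1-3)]] assms(4,5) show ?thesis by simp
  qed
qed

subsection \<open>Covers by planar subgraphs\<close>

text \<open>Replays a list of insertions on the current vertices and faces, in a form that can be
  evaluated on concrete lists.\<close>

fun insertable :: "'a set \<Rightarrow> ('a \<times> 'a \<times> 'a) set \<Rightarrow> ('a \<times> 'a \<times> 'a \<times> 'a) list \<Rightarrow> bool" where
  "insertable V F [] \<longleftrightarrow> True"
| "insertable V F ((w, x, y, z) # ss) \<longleftrightarrow> (x, y, z) \<in> F \<and> w \<notin> V \<and>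
     insertable (insert w V) ({(w, y, z), (x, w, z), (x, y, w)} \<union> (F - {(x, y, z)})) ss"

fun inserted_faces :: "('a \<times> 'a \<times> 'a) set \<Rightarrow> ('a \<times> 'a \<times> 'a \<times> 'a) list \<Rightarrow> ('a \<times> 'a \<times> 'a) set" where
  "inserted_faces F [] = F"
| "inserted_faces F ((w, x, y, z) # ss) =
     inserted_faces ({(w, y, z), (x, w, z), (x, y, w)} \<union> (F - {(x, y, z)})) ss"

fun inserted_edges :: "('a \<times> 'a \<times> 'a \<times> 'a) list \<Rightarrow> 'a set set" where
  "inserted_edges [] = {}"
| "inserted_edges ((w, x, y, z) # ss) = {{w, x}, {w, y}, {w, z}} \<union> inserted_edges ss"

lemma stacked_insertable:
  assumes "stacked V E F" "insertable V F ss"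
  shows "stacked (V \<union> fst ` set ss) (E \<union> inserted_edges ss) (inserted_faces F ss)"
  using assms
proof (induction ss arbitrary: V E F)
  case Nil
  then show ?case by simp
next
  case (Cons s ss)
  obtain w x y z where s: "s = (w, x, y, z)" by (cases s)
  have *: "(x, y, z) \<in> F" "w \<notin> V"
    "insertable (insert w V) ({(w, y, z), (x, w, z), (x, y, w)} \<union> (F - {(x, y, z)})) ss"
    using Cons.prems(2) by (simp_all add: s)
  have "stacked (insert w V \<union> fst ` set ss) ({{w, x}, {w, y}, {w, z}} \<union> E \<union> inserted_edges ss)
      (inserted_faces F (s # ss))"
    unfolding s inserted_faces.simps by (rule Cons.IH [OF stacked_insert [OF Cons.prems(1) *(1,2)] *(3)])
  moreover have "insert w V \<union> fst ` set ss = V \<union> fst ` set (s # ss)" by (simp add: s)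
  moreover have "{{w, x}, {w, y}, {w, z}} \<union> E \<union> inserted_edges ss = E \<union> inserted_edges (s # ss)"
    by (simp add: s Un_ac)
  ultimately show ?case by simp
qed

lemma planar_of_stacked:
  assumes S: "stacked V E F" and G: "verts G \<subseteq> V" "edges G \<subseteq> E" "\<And>e. e \<in> edges G \<Longrightarrow> e \<subseteq> verts G"
  shows "planar G"
proof -
  obtain p where p: "straight p V E F" using S by (auto simp: stacked_def)
  note inj = straight_inj [OF p] and edge = straight_edge [OF p]
  \<comment> \<open>An edge has no preferred direction, so its parametrised segment is obtained by
    choice.\<close>
  have "\<forall>e\<in>edges G. \<exists>g. arc g \<and> {pathstart g, pathfinish g} = p ` e \<and> path_image g = convex hull (p ` e)"
  proof
    fix e assume "e \<in> edges G"
    then have e: "e \<in> E" using G by auto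
    obtain u v where uv: "e = {u, v}" "u \<noteq> v" using edge(2) [OF e] by (auto simp: card_2_iff)
    have "p u \<noteq> p v"
      using inj_onD [OF inj, of u v] uv edge(1) [OF e] by auto
    then show "\<exists>g. arc g \<and> {pathstart g, pathfinish g} = p ` e \<and> path_image g = convex hull (p ` e)"
      by (intro exI [of _ "linepath (p u) (p v)"]) (simp add: uv segment_convex_hull arc_linepath)
  qed
  then obtain \<gamma> where \<gamma>: "\<And>e. e \<in> edges G \<Longrightarrow> arc (\<gamma> e)"
      "\<And>e. e \<in> edges G \<Longrightarrow> {pathstart (\<gamma> e), pathfinish (\<gamma> e)} = p ` e"
      "\<And>e. e \<in> edges G \<Longrightarrow> path_image (\<gamma> e) = convex hull (p ` e)"
    by metis
  have hull: "p ` e \<subseteq> convex hull (p ` e)" for e by (rule hull_subset)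
  have "plane_drawing G p \<gamma>"
    unfolding plane_drawing_def
  proof (intro conjI ballI impI)
    show "inj_on p (verts G)" using inj G(1) by (rule inj_on_subset)
  next
    fix e assume e: "e \<in> edges G"
    then have eE: "e \<in> E" using G(2) by auto
    show "arc (\<gamma> e)" "{pathstart (\<gamma> e), pathfinish (\<gamma> e)} = p ` e" using \<gamma> e by auto
    have "convex hull (p ` e) \<inter> p ` verts G \<subseteq> p ` e"
      using edge(3) [OF eE] G(1) by fast
    moreover have "p ` e \<subseteq> p ` verts G" using G(3) [OF e] by auto
    ultimately show "path_image (\<gamma> e) \<inter> p ` verts G = p ` e"
      using hull [of e] \<gamma>(3) [OF e] by blast
  next
    fix e f assume e: "e \<in> edges G" "f \<in> edges G" "e \<noteq> f"
    then have "convex hull (p ` e) \<inter> convex hull (p ` f) \<subseteq> p ` (e \<inter> f)"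
      using G(2) by (intro straight_edges [OF p]) auto
    moreover have "p ` (e \<inter> f) \<subseteq> p ` e \<inter> p ` f" by blast
    ultimately show "path_image (\<gamma> e) \<inter> path_image (\<gamma> f) = p ` (e \<inter> f)"
      using hull [of e] hull [of f] \<gamma>(3) e by blast
  qed
  then show ?thesis by (auto simp: planar_def)
qed

section \<open>Thickness and covers\<close>

definition planar_cover :: "'a graph \<Rightarrow> 'a graph set \<Rightarrow> bool" where
  "planar_cover G \<H> \<longleftrightarrow> finite \<H> \<and> (\<forall>H\<in>\<H>. subgraph H G \<and> planar H) \<and> graph_Union \<H> = G"

lemma thickness_le:
  assumes "planar_cover G \<H>"
  shows "thickness G \<le> card \<H>"
  using assms unfolding thickness_def planar_cover_def by (intro Least_le) auto

text \<open>The given cover makes the set under \<open>LEAST\<close> nonempty; only then is the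
  minimum known to be attained.\<close>

lemma thickness_attained:
  assumes "planar_cover G \<H>"
  obtains \<H>' where "planar_cover G \<H>'" "card \<H>' = thickness G"
proof -
  have "\<exists>\<H>. finite \<H> \<and> card \<H> = thickness G \<and> (\<forall>H\<in>\<H>. subgraph H G \<and> planar H) \<and> graph_Union \<H> = G"
    unfolding thickness_def
    by (rule LeastI_ex) (use assms in \<open>auto simp: planar_cover_def\<close>)
  then show thesis using that by (auto simp: planar_cover_def)
qed

text \<open>Each drawn edge set is cut down to \<open>edges G\<close>, so it may contain auxiliary
  edges outside \<open>G\<close>. Two sets may become equal, hence the inequality.\<close>

lemma stacked_cover:
  assumes G: "simple_graph G" and fin: "finite \<E>" "\<E> \<noteq> {}"
    and stacked: "\<And>E. E \<in> \<E> \<Longrightarrow> \<exists>V F. verts G \<subseteq> V \<and> stacked V E F"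
    and cover: "edges G \<subseteq> \<Union>\<E>"
  obtains \<H> where "planar_cover G \<H>" "card \<H> \<le> card \<E>"
proof
  let ?H = "\<lambda>E. Graph (verts G) (edges G \<inter> E)"
  show "planar_cover G (?H ` \<E>)"
    unfolding planar_cover_def
  proof (intro conjI ballI)
    show "finite (?H ` \<E>)" using fin by simp
    fix H assume "H \<in> ?H ` \<E>"
    then obtain E where E: "E \<in> \<E>" "H = ?H E" by auto
    show "subgraph H G"
      using G by (auto simp: E(2) subgraph_def simple_graph_def)
    obtain V F where V: "verts G \<subseteq> V" "stacked V E F" using stacked [OF E(1)] by auto
    show "planar H"
      by (rule planar_of_stacked [OF V(2)]) (use V(1) G in \<open>auto simp: E(2) simple_graph_def\<close>)
  next
    have "(\<Union>H\<in>?H ` \<E>. verts H) = verts G" using fin by auto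
    moreover have "(\<Union>H\<in>?H ` \<E>. edges H) = edges G" using cover by auto
    ultimately show "graph_Union (?H ` \<E>) = G"
      by (cases G) (simp add: graph_Union_def)
  qed
  show "card (?H ` \<E>) \<le> card \<E>" using fin by (simp add: card_image_le)
qed

section \<open>Coordinates for \<open>K_{1,1,n,n}\<close>: \<open>A\<close> and \<open>B\<close> are
  the dominating vertices\<close>

abbreviation (input) A :: "nat \<times> nat" where "A \<equiv> (0, 0)"
abbreviation (input) B :: "nat \<times> nat" where "B \<equiv> (1, 0)"
abbreviation (input) U :: "nat \<Rightarrow> nat \<times> nat" where "U j \<equiv> (2, j)"
abbreviation (input) V :: "nat \<Rightarrow> nat \<times> nat" where "V j \<equiv> (3, j)"

definition vertex_set :: "nat \<Rightarrow> (nat \<times> nat) set" where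
  "vertex_set n = {A, B} \<union> {2, 3} \<times> {..<n}"

definition edge_set :: "nat \<Rightarrow> (nat \<times> nat) set set" where
  "edge_set n = {{A, B}} \<union> (\<Union>j<n. {{A, U j}, {A, V j}, {B, U j}, {B, V j}}) \<union>
     (\<Union>i<n. \<Union>j<n. {{U i, V j}})"

lemma mem_vertex_set:
  "(i, j) \<in> vertex_set n \<longleftrightarrow> i \<in> {0, 1} \<and> j = 0 \<or> i \<in> {2, 3} \<and> j < n"
  by (auto simp: vertex_set_def)

lemma verts_K: "verts (complete_multipartite [1, 1, n, n]) = vertex_set n"
proof -
  have "(i, j) \<in> verts (complete_multipartite [1, 1, n, n]) \<longleftrightarrow> (i, j) \<in> vertex_set n" for i j
  proof -
    consider "i = 0" | "i = 1" | "i = 2" | "i = 3" | "i \<ge> 4" by linarith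
    then show ?thesis
      by cases (simp_all add: complete_multipartite_def Let_def mem_vertex_set numeral_3_eq_3)
  qed
  then show ?thesis by auto
qed

lemma mem_edge_set:
  "{A, B} \<in> edge_set n"
  "j < n \<Longrightarrow> {A, U j} \<in> edge_set n" "j < n \<Longrightarrow> {A, V j} \<in> edge_set n"
  "j < n \<Longrightarrow> {B, U j} \<in> edge_set n" "j < n \<Longrightarrow> {B, V j} \<in> edge_set n"
  "i < n \<Longrightarrow> j < n \<Longrightarrow> {U i, V j} \<in> edge_set n"
proof -
  show "{A, B} \<in> edge_set n"
    by (simp add: edge_set_def)
  show "j < n \<Longrightarrow> {A, U j} \<in> edge_set n" "j < n \<Longrightarrow> {A, V j} \<in> edge_set n"
    "j < n \<Longrightarrow> {B, U j} \<in> edge_set n" "j < n \<Longrightarrow> {B, V j} \<in> edge_set n"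
    unfolding edge_set_def by blast+
  show "i < n \<Longrightarrow> j < n \<Longrightarrow> {U i, V j} \<in> edge_set n"
    unfolding edge_set_def by (rule UnI2, rule UN_I [of i], simp, rule UN_I [of j]) simp_all
qed

lemma edge_setI:
  assumes "u \<in> vertex_set n" "v \<in> vertex_set n" "fst u < fst v"
  shows "{u, v} \<in> edge_set n"
proof -
  obtain i j i' j' where uv: "u = (i, j)" "v = (i', j')" by (metis surj_pair)
  have "(i = 0 \<or> i = 1) \<and> j = 0 \<or> (i = 2 \<or> i = 3) \<and> j < n"
    "(i' = 0 \<or> i' = 1) \<and> j' = 0 \<or> (i' = 2 \<or> i' = 3) \<and> j' < n"
    using assms(1,2) by (simp_all add: uv mem_vertex_set)
  moreover have "i < i'" using assms(3) by (simp add: uv)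
  ultimately consider "u = A" "v = B" | "u = A" "v = U j'" "j' < n" | "u = A" "v = V j'" "j' < n"
    | "u = B" "v = U j'" "j' < n" | "u = B" "v = V j'" "j' < n" | "u = U j" "v = V j'" "j < n" "j' < n"
    unfolding uv by fastforce
  then show ?thesis
    using mem_edge_set by cases simp_all
qed

lemma edges_K: "edges (complete_multipartite [1, 1, n, n]) = edge_set n"
proof -
  have E: "edges (complete_multipartite [1, 1, n, n]) =
    {{u, v} | u v. u \<in> vertex_set n \<and> v \<in> vertex_set n \<and> fst u \<noteq> fst v}"
    unfolding verts_K [symmetric] by (simp add: complete_multipartite_def Let_def)
  show ?thesis
  proof
    show "edges (complete_multipartite [1, 1, n, n]) \<subseteq> edge_set n"
    proof
      fix e assume "e \<in> edges (complete_multipartite [1, 1, n, n])"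
      then obtain u v where uv: "e = {u, v}" "u \<in> vertex_set n" "v \<in> vertex_set n" "fst u \<noteq> fst v"
        unfolding E by blast
      then consider "fst u < fst v" | "fst v < fst u" by linarith
      then show "e \<in> edge_set n"
        using edge_setI [of u n v] edge_setI [of v n u] uv by cases (simp_all add: insert_commute)
    qed
    have "{u, v} \<in> edges (complete_multipartite [1, 1, n, n])"
      if "u \<in> vertex_set n" "v \<in> vertex_set n" "fst u \<noteq> fst v" for u v
      unfolding E using that by blast
    then show "edge_set n \<subseteq> edges (complete_multipartite [1, 1, n, n])"
      unfolding edge_set_def by (auto simp: mem_vertex_set simp del: One_nat_def)
  qed
qed

lemma edge_set_subsetI:
  assumes "{A, B} \<in> E"
    and "\<forall>j<n. {A, U j} \<in> E \<and> {A, V j} \<in> E \<and> {B, U j} \<in> E \<and> {B, V j} \<in> E"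
    and "\<forall>i<n. \<forall>j<n. {U i, V j} \<in> E"
  shows "edge_set n \<subseteq> E"
  using assms by (auto simp: edge_set_def)

lemma vertex_set_subsetI:
  assumes "A \<in> S" "B \<in> S" "\<forall>j<n. U j \<in> S \<and> V j \<in> S"
  shows "vertex_set n \<subseteq> S"
  using assms by (auto simp: vertex_set_def)

lemma vertex_set_mono: "n \<le> m \<Longrightarrow> vertex_set n \<subseteq> vertex_set m"
  by (auto simp: vertex_set_def)

lemma edge_set_mono: "n \<le> m \<Longrightarrow> edge_set n \<subseteq> edge_set m"
  by (intro edge_set_subsetI allI impI conjI mem_edge_set) simp_all

text \<open>A cover for \<open>m\<close> restricts to every \<open>n \<le> m\<close>, so only the
  values \<open>m = 4 * p + 1\<close> need constructions.\<close>

lemma planar_cover_of_stacked: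
  assumes "n \<le> m" "finite \<E>" "\<E> \<noteq> {}"
    and "\<And>E. E \<in> \<E> \<Longrightarrow> \<exists>V F. vertex_set m \<subseteq> V \<and> stacked V E F"
    and "edge_set m \<subseteq> \<Union>\<E>"
  obtains \<H> where "planar_cover (complete_multipartite [1, 1, n, n]) \<H>" "card \<H> \<le> card \<E>"
proof (rule stacked_cover [OF simple_graph_complete_multipartite assms(2,3)])
  show "\<exists>V F. verts (complete_multipartite [1, 1, n, n]) \<subseteq> V \<and> stacked V E F" if "E \<in> \<E>" for E
    unfolding verts_K using assms(4) [OF that] vertex_set_mono [OF assms(1)] by (meson order_trans)
  show "edges (complete_multipartite [1, 1, n, n]) \<subseteq> \<Union>\<E>"
    unfolding edges_K using edge_set_mono [OF assms(1)] assms(5) by (rule order_trans)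
qed (rule that)

lemma infinite_nat_pairs: "infinite (UNIV :: (nat \<times> nat) set)"
  by (simp add: finite_prod)

section \<open>Checking explicit triangulations by evaluation\<close>

fun step_pairs :: "'a \<times> 'a \<times> 'a \<times> 'a \<Rightarrow> ('a \<times> 'a) list" where
  "step_pairs (w, x, y, z) = [(w, x), (w, y), (w, z)]"

lemma inserted_edges_eq: "inserted_edges ss = (\<lambda>(u, v). {u, v}) ` set (concat (map step_pairs ss))"
  by (induction ss rule: inserted_edges.induct) auto

text \<open>A stacked triangulation is given by its outer triangle and the insertions \<open>(w, x, y, z)\<close> of a new
  vertex \<open>w\<close> into a face \<open>(x, y, z)\<close>.\<close>

fun triangulation_pairs :: "('a \<times> 'a \<times> 'a) \<times> ('a \<times> 'a \<times> 'a \<times> 'a) list \<Rightarrow> ('a \<times> 'a) list" where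
  "triangulation_pairs ((x, y, z), ss) = [(x, y), (y, z), (x, z)] @ concat (map step_pairs ss)"

fun triangulation_on :: "'a list \<Rightarrow> ('a \<times> 'a \<times> 'a) \<times> ('a \<times> 'a \<times> 'a \<times> 'a) list \<Rightarrow> bool" where
  "triangulation_on vs ((x, y, z), ss) \<longleftrightarrow> x \<noteq> y \<and> y \<noteq> z \<and> x \<noteq> z \<and>
     insertable {x, y, z} {(x, y, z)} ss \<and> list_all (\<lambda>v. List.member ([x, y, z] @ map fst ss) v) vs"

lemma triangulation_stacked:
  fixes t :: "((nat \<times> nat) \<times> (nat \<times> nat) \<times> (nat \<times> nat)) \<times> ((nat \<times> nat) \<times> (nat \<times> nat) \<times> (nat \<times> nat) \<times> (nat \<times> nat)) list"
  assumes "triangulation_on vs t"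
  shows "\<exists>S F. set vs \<subseteq> S \<and> stacked S ((\<lambda>(u, v). {u, v}) ` set (triangulation_pairs t)) F"
proof -
  obtain x y z ss where t: "t = ((x, y, z), ss)" by (metis surj_pair)
  have *: "x \<noteq> y" "y \<noteq> z" "x \<noteq> z" "insertable {x, y, z} {(x, y, z)} ss"
    "set vs \<subseteq> {x, y, z} \<union> fst ` set ss"
    using assms by (auto simp: t list_all_iff)
  have "stacked ({x, y, z} \<union> fst ` set ss) ({{x, y}, {y, z}, {x, z}} \<union> inserted_edges ss)
      (inserted_faces {(x, y, z)} ss)"
    by (rule stacked_insertable [OF stacked_triangle [OF infinite_nat_pairs *(1-3)] *(4)])
  moreover have "{{x, y}, {y, z}, {x, z}} \<union> inserted_edges ss = (\<lambda>(u, v). {u, v}) ` set (triangulation_pairs t)"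
    by (simp add: t inserted_edges_eq image_Un)
  ultimately show ?thesis using *(5) by metis
qed

definition vertex_list :: "nat \<Rightarrow> (nat \<times> nat) list" where
  "vertex_list n = A # B # map U [0..<n] @ map V [0..<n]"

definition pair_list :: "nat \<Rightarrow> ((nat \<times> nat) \<times> (nat \<times> nat)) list" where
  "pair_list n = (A, B) # concat (map (\<lambda>j. [(A, U j), (A, V j), (B, U j), (B, V j)]) [0..<n]) @
     List.product (map U [0..<n]) (map V [0..<n])"

text \<open>Edges are compared as ordered pairs, in both orders, so that coverage becomes a search
  in lists.\<close>

definition triangulation_cover where
  "triangulation_cover n ts \<longleftrightarrow> ts \<noteq> [] \<and> list_all (triangulation_on (vertex_list n)) ts \<and>
     list_all (\<lambda>(u, v). list_ex (\<lambda>t. List.member (triangulation_pairs t) (u, v) \<or>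
       List.member (triangulation_pairs t) (v, u)) ts) (pair_list n)"

lemma planar_cover_of_triangulations:
  assumes cover: "triangulation_cover m ts" and "n \<le> m"
  obtains \<H> where "planar_cover (complete_multipartite [1, 1, n, n]) \<H>" "card \<H> \<le> length ts"
proof -
  let ?E = "\<lambda>t. (\<lambda>(u, v). {u, v}) ` set (triangulation_pairs t)"
  have V: "set (vertex_list m) = vertex_set m"
    by (auto simp: vertex_list_def vertex_set_def)
  have "{u, v} \<in> \<Union> (?E ` set ts)" if "(u, v) \<in> set (pair_list m)" for u v
  proof -
    have "\<forall>q\<in>set (pair_list m). case q of (u, v) \<Rightarrow> \<exists>t\<in>set ts.
        (u, v) \<in> set (triangulation_pairs t) \<or> (v, u) \<in> set (triangulation_pairs t)"
      using cover by (simp add: triangulation_cover_def list_all_iff list_ex_iff del: triangulation_pairs.simps)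
    from bspec [OF this that] obtain t where t: "t \<in> set ts"
      "(u, v) \<in> set (triangulation_pairs t) \<or> (v, u) \<in> set (triangulation_pairs t)"
      by (simp del: triangulation_pairs.simps) blast
    from t(2) have "{u, v} \<in> ?E t"
    proof
      assume "(u, v) \<in> set (triangulation_pairs t)"
      then show ?thesis by (rule image_eqI [rotated]) simp
    next
      assume "(v, u) \<in> set (triangulation_pairs t)"
      then show ?thesis by (rule image_eqI [rotated]) (simp add: insert_commute)
    qed
    then show ?thesis by (rule UnionI [OF imageI [OF t(1)]])
  qed
  then have "edge_set m \<subseteq> \<Union> (?E ` set ts)"
    by (intro edge_set_subsetI allI impI conjI) (simp_all add: pair_list_def)
  note cov = this
  have st: "\<exists>S F. vertex_set m \<subseteq> S \<and> stacked S E F" if "E \<in> ?E ` set ts" for E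
    using that cover triangulation_stacked [of "vertex_list m"]
    unfolding V by (auto simp: triangulation_cover_def list_all_iff)
  have "?E ` set ts \<noteq> {}" using cover by (simp add: triangulation_cover_def)
  from planar_cover_of_stacked [OF \<open>n \<le> m\<close> finite_imageI [OF finite_set] this st cov]
  obtain \<H> where "planar_cover (complete_multipartite [1, 1, n, n]) \<H>" "card \<H> \<le> card (?E ` set ts)"
    by metis
  moreover have "card (?E ` set ts) \<le> length ts"
    by (meson card_image_le card_length finite_set order_trans)
  ultimately show thesis using that by (meson order_trans)
qed

text \<open>The graph \<open>K_{1,1,1,1}\<close> is the complete graph on four vertices, obtained by
  one insertion into a triangle.\<close>

lemma triangulation_cover_1: "triangulation_cover 1 [((A, B, U 0), [(V 0, A, B, U 0)])]"
  by code_simp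

text \<open>For \<open>p \<le> 2\<close> the blocks \<open>r\<close>, \<open>r + 1\<close>,
  \<open>r + 2\<close> modulo \<open>p\<close> are not distinct, as the general family requires;
  hence the explicit covers for 5 and 9.\<close>

lemma triangulation_cover_5: "triangulation_cover 5
  [((A, U 0, U 3),
     [(V 0, A, U 0, U 3), (V 3, A, U 0, V 0), (U 2, A, V 3, V 0), (V 2, A, V 3, U 2),
      (B, V 2, V 3, U 2), (U 1, A, V 3, V 2), (U 4, A, V 0, U 3), (V 1, A, U 4, U 3),
      (V 4, A, V 1, U 3)]),
   ((A, B, U 4),
     [(V 3, A, B, U 4), (V 2, V 3, B, U 4), (V 4, V 2, B, U 4), (U 0, V 2, B, V 4),
      (V 1, U 0, B, V 4), (U 1, V 1, B, V 4), (U 2, V 1, U 1, V 4), (U 3, V 3, B, V 2),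
      (V 0, V 1, B, U 1)])]"
  by code_simp

lemma triangulation_cover_9: "triangulation_cover 9
  [((A, U 0, V 0),
     [(U 5, A, U 0, V 0), (V 7, A, U 5, V 0), (U 4, A, V 7, V 0), (V 5, A, U 4, V 0),
      (U 6, A, V 5, V 0), (U 1, A, V 5, U 6), (V 2, A, U 1, U 6), (U 2, V 2, U 1, U 6),
      (V 6, U 2, U 1, U 6), (B, U 2, V 6, U 6), (U 3, U 6, V 5, V 0), (V 4, U 6, U 3, V 0),
      (U 7, U 6, V 4, V 0), (V 1, A, U 5, V 7), (U 8, V 1, U 5, V 7), (V 3, A, U 0, U 5),
      (V 8, A, V 5, U 1)]),
   ((A, B, U 8),
     [(V 4, A, B, U 8), (U 2, A, V 4, U 8), (U 0, U 2, V 4, U 8), (V 2, U 0, V 4, U 8),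
      (U 1, V 2, V 4, U 8), (V 5, U 2, U 0, U 8), (U 7, U 2, U 0, V 5), (V 8, U 2, U 0, U 7),
      (V 7, V 8, U 0, U 7), (V 1, V 7, U 0, U 7), (U 3, V 7, U 0, V 1), (V 6, U 0, V 2, U 8),
      (U 4, V 6, V 2, U 8), (U 5, V 6, V 2, U 4), (U 6, V 7, V 1, U 7), (V 0, U 2, V 5, U 8),
      (V 3, U 2, V 0, U 8)]),
   ((A, U 3, U 7),
     [(V 6, A, U 3, U 7), (V 2, V 6, U 3, U 7), (B, V 2, U 3, U 7), (V 3, B, U 3, U 7),
      (U 0, B, V 3, U 7), (V 8, B, U 3, V 3), (U 4, B, V 8, V 3), (V 1, B, U 4, V 3),
      (U 1, B, V 1, V 3), (V 7, B, V 1, U 1), (U 2, B, V 1, V 7), (V 4, B, V 8, U 4),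
      (U 5, B, V 8, V 4), (U 6, V 8, U 3, V 3), (U 8, B, U 3, V 8), (V 0, B, V 7, U 1),
      (V 5, B, V 8, U 5)])]"
  by code_simp

subsection \<open>A family of covers\<close>

text \<open>With \<open>p\<close> blocks, the two vertices outside them are \<open>Ub p 0\<close> and \<open>Vb p 0\<close>.\<close>

definition Ub :: "nat \<Rightarrow> nat \<Rightarrow> nat \<times> nat" where "Ub r i = U (4 * r + i)"
definition Vb :: "nat \<Rightarrow> nat \<Rightarrow> nat \<times> nat" where "Vb r i = V (4 * r + i)"

lemma block_eq [simp]:
  "i < 4 \<Longrightarrow> j < 4 \<Longrightarrow> Ub r i = Ub s j \<longleftrightarrow> r = s \<and> i = j"
  "i < 4 \<Longrightarrow> j < 4 \<Longrightarrow> Vb r i = Vb s j \<longleftrightarrow> r = s \<and> i = j"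
  by (simp_all add: Ub_def Vb_def, presburger+)

lemma block_neq [simp]:
  "Ub r i \<noteq> Vb s j" "Vb s j \<noteq> Ub r i" "Ub r i \<noteq> A" "A \<noteq> Ub r i" "Ub r i \<noteq> B" "B \<noteq> Ub r i"
  "Vb r i \<noteq> A" "A \<noteq> Vb r i" "Vb r i \<noteq> B" "B \<noteq> Vb r i"
  "Ub r i \<noteq> (Suc 0, 0)" "(Suc 0, 0) \<noteq> Ub r i" "Vb r i \<noteq> (Suc 0, 0)" "(Suc 0, 0) \<noteq> Vb r i"
  by (simp_all add: Ub_def Vb_def)

lemma block_cases:
  assumes "j < 4 * p + 1"
  obtains "U j = Ub p 0" "V j = Vb p 0"
    | r i where "r < p" "i \<in> {0, 1, 2, 3}" "U j = Ub r i" "V j = Vb r i"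
proof (cases "j = 4 * p")
  case True
  then show thesis by (intro that(1)) (simp_all add: Ub_def Vb_def)
next
  case False
  have "j mod 4 \<in> {0, 1, 2, 3}" by auto
  with False assms show thesis
    by (intro that(2) [of "j div 4" "j mod 4"]) (auto simp: Ub_def Vb_def)
qed

text \<open>All edges inside a block except those from \<open>Ub r 2\<close> to
  \<open>Vb r 2\<close>, \<open>Vb r 3\<close> and from \<open>Ub r 3\<close> to
  \<open>Vb r 0\<close>, \<open>Vb r 1\<close>. These four are left to the last graph.\<close>

definition core_edges :: "nat \<Rightarrow> (nat \<times> nat) set set" where
  "core_edges r = {{Ub r 0, Vb r 0}, {Ub r 0, Vb r 1}, {Ub r 0, Vb r 2}, {Ub r 0, Vb r 3},
     {Ub r 1, Vb r 0}, {Ub r 1, Vb r 1}, {Ub r 1, Vb r 2}, {Ub r 1, Vb r 3},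
     {Ub r 2, Vb r 0}, {Ub r 2, Vb r 1}, {Ub r 3, Vb r 2}, {Ub r 3, Vb r 3}}"

definition block :: "nat \<Rightarrow> (nat \<times> nat) set" where
  "block r = {Ub r 0, Ub r 1, Ub r 2, Ub r 3, Vb r 0, Vb r 1, Vb r 2, Vb r 3}"

text \<open>The \<open>Vb\<close> vertices are stacked between the poles \<open>Ub r 0\<close> and
  \<open>Ub r 1\<close>, then \<open>Ub r 2\<close> and \<open>Ub r 3\<close> are inserted. The four
  faces kept contain the pole pairs of the four fans to come.\<close>

lemma stacked_core:
  "stacked (block r) (core_edges r)
    {(Ub r 0, Ub r 2, Vb r 0), (Ub r 3, Ub r 1, Vb r 2), (Vb r 1, Ub r 1, Vb r 0), (Ub r 0, Vb r 3, Vb r 2)}"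
proof -
  let ?ss = "[(Vb r 1, Ub r 0, Ub r 1, Vb r 0), (Vb r 2, Ub r 0, Ub r 1, Vb r 1),
     (Vb r 3, Ub r 0, Ub r 1, Vb r 2), (Ub r 2, Ub r 0, Vb r 1, Vb r 0), (Ub r 3, Vb r 3, Ub r 1, Vb r 2)]"
  have "stacked ({Ub r 0, Ub r 1, Vb r 0} \<union> fst ` set ?ss)
     ({{Ub r 0, Ub r 1}, {Ub r 1, Vb r 0}, {Ub r 0, Vb r 0}} \<union> inserted_edges ?ss)
     (inserted_faces {(Ub r 0, Ub r 1, Vb r 0)} ?ss)"
    by (rule stacked_insertable [OF stacked_triangle [OF infinite_nat_pairs]]) simp_all
  then show ?thesis
    by (rule stacked_subset) (simp_all add: block_def core_edges_def insert_commute, auto)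
qed

lemma stacked_core_fans:
  assumes dist: "distinct (ws1 @ ws2 @ ws3 @ ws4)"
    and new: "set (ws1 @ ws2 @ ws3 @ ws4) \<inter> block r = {}"
  shows "\<exists>F. stacked (block r \<union> set (ws1 @ ws2 @ ws3 @ ws4))
    (core_edges r \<union> fan (Ub r 0) (Ub r 2) (Vb r 0) ws1 \<union> fan (Ub r 1) (Ub r 3) (Vb r 2) ws2 \<union>
     fan (Vb r 0) (Vb r 1) (Ub r 1) ws3 \<union> fan (Vb r 2) (Vb r 3) (Ub r 0) ws4) F"
proof -
  let ?F = "{(Ub r 0, Ub r 2, Vb r 0), (Ub r 3, Ub r 1, Vb r 2), (Vb r 1, Ub r 1, Vb r 0), (Ub r 0, Vb r 3, Vb r 2)}"
  have 1: "stacked (block r \<union> set ws1) (core_edges r \<union> fan (Ub r 0) (Ub r 2) (Vb r 0) ws1)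
      (?F - {(Ub r 0, Ub r 2, Vb r 0)})"
    by (rule stacked_fan [OF stacked_core]) (use dist new in auto)
  have 2: "stacked (block r \<union> set ws1 \<union> set ws2)
      (core_edges r \<union> fan (Ub r 0) (Ub r 2) (Vb r 0) ws1 \<union> fan (Ub r 1) (Ub r 3) (Vb r 2) ws2)
      (?F - {(Ub r 0, Ub r 2, Vb r 0)} - {(Ub r 3, Ub r 1, Vb r 2)})"
    by (rule stacked_fan [OF 1]) (use dist new in auto)
  have 3: "stacked (block r \<union> set ws1 \<union> set ws2 \<union> set ws3)
      (core_edges r \<union> fan (Ub r 0) (Ub r 2) (Vb r 0) ws1 \<union> fan (Ub r 1) (Ub r 3) (Vb r 2) ws2 \<union>
       fan (Vb r 0) (Vb r 1) (Ub r 1) ws3)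
      (?F - {(Ub r 0, Ub r 2, Vb r 0)} - {(Ub r 3, Ub r 1, Vb r 2)} - {(Vb r 1, Ub r 1, Vb r 0)})"
    by (rule stacked_fan [OF 2]) (use dist new in auto)
  have "stacked (block r \<union> set ws1 \<union> set ws2 \<union> set ws3 \<union> set ws4)
      (core_edges r \<union> fan (Ub r 0) (Ub r 2) (Vb r 0) ws1 \<union> fan (Ub r 1) (Ub r 3) (Vb r 2) ws2 \<union>
       fan (Vb r 0) (Vb r 1) (Ub r 1) ws3 \<union> fan (Vb r 2) (Vb r 3) (Ub r 0) ws4)
      (?F - {(Ub r 0, Ub r 2, Vb r 0)} - {(Ub r 3, Ub r 1, Vb r 2)} - {(Vb r 1, Ub r 1, Vb r 0)} -
       {(Ub r 0, Vb r 3, Vb r 2)})"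
    by (rule stacked_fan [OF 3]) (use dist new in auto)
  then show ?thesis by (auto simp: Un_assoc)
qed

definition pairs :: "(nat \<Rightarrow> nat \<Rightarrow> nat \<times> nat) \<Rightarrow> nat \<Rightarrow> nat \<Rightarrow> nat list \<Rightarrow> (nat \<times> nat) list" where
  "pairs f i j rs = concat (map (\<lambda>r. [f r i, f r j]) rs)"

lemma set_pairs: "set (pairs f i j rs) = (\<Union>r\<in>set rs. {f r i, f r j})"
  by (simp add: pairs_def)

lemma distinct_pairs:
  assumes "distinct rs" "i < 4" "j < 4" "i \<noteq> j"
  shows "distinct (pairs Ub i j rs)" "distinct (pairs Vb i j rs)"
  using assms by (induction rs) (auto simp: pairs_def)

lemma fan_consecutive_concat:
  assumes "r \<in> set rs" "f r = us @ w # w' # ws"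
  shows "{w, w'} \<in> fan x y z (concat (map f rs))"
proof -
  obtain rs1 rs2 where "rs = rs1 @ r # rs2" using split_list [OF assms(1)] by auto
  then have "concat (map f rs) = (concat (map f rs1) @ us) @ w # w' # (ws @ concat (map f rs2))"
    using assms(2) by simp
  then show ?thesis by (simp only: fan_consecutive)
qed

text \<open>The order within a block makes \<open>Ub r 2\<close> consecutive with
  \<open>Vb r 2\<close> and \<open>Vb r 3\<close>; likewise \<open>last_list2\<close> puts
  \<open>Ub r 3\<close> between \<open>Vb r 0\<close> and \<open>Vb r 1\<close>. The paths of the
  fans thus supply the edges missing from \<open>core_edges\<close>.\<close>

definition last_list1 :: "nat \<Rightarrow> (nat \<times> nat) list" where
  "last_list1 p = concat (map (\<lambda>r. [Vb r 2, Ub r 2, Vb r 3, Ub r 0]) [0..<p])"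

definition last_list2 :: "nat \<Rightarrow> (nat \<times> nat) list" where
  "last_list2 p = concat (map (\<lambda>r. [Vb r 0, Ub r 3, Vb r 1, Ub r 1]) [0..<p])"

text \<open>A complete graph on \<open>A\<close>, \<open>B\<close> and the two vertices outside the
  blocks, with two of its faces filled by fans.\<close>

definition last_graph :: "nat \<Rightarrow> (nat \<times> nat) set set" where
  "last_graph p = {{A, B}, {A, Ub p 0}, {B, Ub p 0}, {A, Vb p 0}, {B, Vb p 0}, {Ub p 0, Vb p 0}} \<union>
     fan A B (Vb p 0) (last_list1 p) \<union> fan (Ub p 0) (Vb p 0) B (last_list2 p)"

lemma set_last_lists:
  "set (last_list1 p) = (\<Union>r<p. {Vb r 2, Ub r 2, Vb r 3, Ub r 0})"
  "set (last_list2 p) = (\<Union>r<p. {Vb r 0, Ub r 3, Vb r 1, Ub r 1})"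
  by (simp_all add: last_list1_def last_list2_def atLeast0LessThan)

lemma distinct_last_lists: "distinct (last_list1 p)" "distinct (last_list2 p)"
proof -
  have "distinct (concat (map (\<lambda>r. [Vb r 2, Ub r 2, Vb r 3, Ub r 0]) rs))"
    "distinct (concat (map (\<lambda>r. [Vb r 0, Ub r 3, Vb r 1, Ub r 1]) rs))" if "distinct rs" for rs
    using that by (induction rs) auto
  then show "distinct (last_list1 p)" "distinct (last_list2 p)"
    by (simp_all add: last_list1_def last_list2_def)
qed

lemma vertex_set_subset_blocks:
  assumes "A \<in> S" "B \<in> S" "Ub p 0 \<in> S" "Vb p 0 \<in> S" "\<And>r. r < p \<Longrightarrow> block r \<subseteq> S"
  shows "vertex_set (4 * p + 1) \<subseteq> S"
proof (rule vertex_set_subsetI)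
  show "\<forall>j<4 * p + 1. U j \<in> S \<and> V j \<in> S"
  proof (intro allI impI)
    fix j assume "j < 4 * p + 1"
    then show "U j \<in> S \<and> V j \<in> S"
    proof (cases rule: block_cases)
      case 1
      then show ?thesis using assms by simp
    next
      case (2 r i)
      then show ?thesis using assms(5) [of r] by (auto simp: block_def)
    qed
  qed
qed (use assms in auto)

lemma stacked_last_graph:
  "\<exists>S F. vertex_set (4 * p + 1) \<subseteq> S \<and> stacked S (last_graph p) F"
proof -
  let ?K = "{{A, B}, {A, Ub p 0}, {B, Ub p 0}, {A, Vb p 0}, {B, Vb p 0}, {Ub p 0, Vb p 0}}"
  let ?F = "{(A, B, Vb p 0), (Vb p 0, B, Ub p 0)}"
  have "stacked {A, B, Ub p 0} {{A, B}, {B, Ub p 0}, {A, Ub p 0}} {(A, B, Ub p 0)}"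
    by (rule stacked_triangle [OF infinite_nat_pairs]) simp_all
  from stacked_insert [OF this, of A B "Ub p 0" "Vb p 0"]
  have "stacked (insert (Vb p 0) {A, B, Ub p 0}) ({{Vb p 0, A}, {Vb p 0, B}, {Vb p 0, Ub p 0}} \<union>
      {{A, B}, {B, Ub p 0}, {A, Ub p 0}}) ({(Vb p 0, B, Ub p 0), (A, Vb p 0, Ub p 0), (A, B, Vb p 0)} \<union>
      ({(A, B, Ub p 0)} - {(A, B, Ub p 0)}))"
    by simp
  then have "stacked {A, B, Ub p 0, Vb p 0} ?K ?F"
    by (rule stacked_subset) (simp_all add: insert_commute, auto)
  have 1: "stacked ({A, B, Ub p 0, Vb p 0} \<union> set (last_list1 p))
      (?K \<union> fan A B (Vb p 0) (last_list1 p)) (?F - {(A, B, Vb p 0)})"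
    by (rule stacked_fan [OF \<open>stacked {A, B, Ub p 0, Vb p 0} ?K ?F\<close>])
      (auto simp: distinct_last_lists set_last_lists)
  have "stacked ({A, B, Ub p 0, Vb p 0} \<union> set (last_list1 p) \<union> set (last_list2 p))
      (?K \<union> fan A B (Vb p 0) (last_list1 p) \<union> fan (Ub p 0) (Vb p 0) B (last_list2 p))
      (?F - {(A, B, Vb p 0)} - {(Vb p 0, B, Ub p 0)})"
    by (rule stacked_fan [OF 1]) (auto simp: distinct_last_lists set_last_lists)
  moreover have "vertex_set (4 * p + 1) \<subseteq>
      {A, B, Ub p 0, Vb p 0} \<union> set (last_list1 p) \<union> set (last_list2 p)"
    by (rule vertex_set_subset_blocks) (auto simp: set_last_lists block_def)
  ultimately show ?thesis unfolding last_graph_def by blast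
qed

section \<open>The graphs of the blocks, with cyclic successors given by addition modulo
  \<open>p\<close>\<close>

definition shift :: "nat \<Rightarrow> nat \<Rightarrow> nat \<Rightarrow> nat" where
  "shift p k r = (if r + k < p then r + k else r + k - p)"

lemma shift:
  assumes "r < p" "p \<ge> 3"
  shows "shift p 1 r < p" "shift p 2 r < p" "shift p 1 r \<noteq> r" "shift p 2 r \<noteq> r" "shift p 1 r \<noteq> shift p 2 r"
  using assms by (auto simp: shift_def)

lemma shift_surj:
  assumes "s < p" "p \<ge> 3"
  shows "\<exists>r<p. shift p 1 r = s" "\<exists>r<p. shift p 2 r = s"
proof -
  show "\<exists>r<p. shift p 1 r = s"
    using assms by (intro exI [of _ "if s \<ge> 1 then s - 1 else s + p - 1"]) (auto simp: shift_def)
  show "\<exists>r<p. shift p 2 r = s"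
    using assms by (intro exI [of _ "if s \<ge> 2 then s - 2 else s + p - 2"]) (auto simp: shift_def)
qed

definition others :: "nat \<Rightarrow> nat \<Rightarrow> nat list" where
  "others p r = filter (\<lambda>s. s \<noteq> r) [0..<p]"

definition ws1 :: "nat \<Rightarrow> nat \<Rightarrow> (nat \<times> nat) list" where
  "ws1 p r = Vb p 0 # pairs Vb 2 3 (others p r)"

text \<open>The order matters: along the path \<open>A\<close> is adjacent to both listed vertices
  of block \<open>r + 1\<close>, while \<open>B\<close> is adjacent to \<open>Vb\<close> number 1 of
  block \<open>r + 1\<close> and number 0 of block \<open>r + 2\<close>. As \<open>r\<close> varies,
  \<open>A\<close> and \<open>B\<close> each reach all \<open>Vb s 0\<close> and
  \<open>Vb s 1\<close>.\<close>

definition ws2 :: "nat \<Rightarrow> nat \<Rightarrow> (nat \<times> nat) list" where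
  "ws2 p r = [Vb (shift p 1 r) 0, A, Vb (shift p 1 r) 1, B, Vb (shift p 2 r) 0, Vb (shift p 2 r) 1] @
     pairs Vb 0 1 (filter (\<lambda>s. s \<noteq> shift p 1 r \<and> s \<noteq> shift p 2 r) (others p r))"

definition ws3 :: "nat \<Rightarrow> nat \<Rightarrow> (nat \<times> nat) list" where
  "ws3 p r = pairs Ub 0 2 (others p r)"

definition ws4 :: "nat \<Rightarrow> nat \<Rightarrow> (nat \<times> nat) list" where
  "ws4 p r = Ub p 0 # pairs Ub 1 3 (others p r)"

text \<open>The fans split the edges between blocks: \<open>Ub r i\<close> and \<open>Vb s k\<close>
  are joined in graph \<open>r\<close> if \<open>i\<close> is even and \<open>k \<ge> 2\<close>, or
  \<open>i\<close> is odd and \<open>k \<le> 1\<close>; otherwise in graph \<open>s\<close>.\<close>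

definition block_graph :: "nat \<Rightarrow> nat \<Rightarrow> (nat \<times> nat) set set" where
  "block_graph p r = core_edges r \<union> fan (Ub r 0) (Ub r 2) (Vb r 0) (ws1 p r) \<union>
     fan (Ub r 1) (Ub r 3) (Vb r 2) (ws2 p r) \<union> fan (Vb r 0) (Vb r 1) (Ub r 1) (ws3 p r) \<union>
     fan (Vb r 2) (Vb r 3) (Ub r 0) (ws4 p r)"

lemma set_others [simp]: "set (others p r) = {s. s < p \<and> s \<noteq> r}"
  by (auto simp: others_def)

lemma distinct_others [simp]: "distinct (others p r)"
  by (simp add: others_def)

lemma set_ws:
  "set (ws1 p r) = {Vb p 0} \<union> (\<Union>s\<in>{s. s < p \<and> s \<noteq> r}. {Vb s 2, Vb s 3})"
  "r < p \<Longrightarrow> p \<ge> 3 \<Longrightarrow> set (ws2 p r) = {A, B} \<union> (\<Union>s\<in>{s. s < p \<and> s \<noteq> r}. {Vb s 0, Vb s 1})"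
  "set (ws3 p r) = (\<Union>s\<in>{s. s < p \<and> s \<noteq> r}. {Ub s 0, Ub s 2})"
  "set (ws4 p r) = {Ub p 0} \<union> (\<Union>s\<in>{s. s < p \<and> s \<noteq> r}. {Ub s 1, Ub s 3})"
  using shift [of r p] by (auto simp: ws1_def ws2_def ws3_def ws4_def set_pairs)

text \<open>The four lists are disjoint, and together with the block they exhaust the
  vertices.\<close>

lemma stacked_block_graph:
  assumes r: "r < p" and p: "p \<ge> 3"
  shows "\<exists>S F. vertex_set (4 * p + 1) \<subseteq> S \<and> stacked S (block_graph p r) F"
proof -
  have "distinct (ws1 p r)" "distinct (ws2 p r)" "distinct (ws3 p r)" "distinct (ws4 p r)"
    using r shift [OF r p]
    by (auto simp: ws1_def ws2_def ws3_def ws4_def set_pairs intro!: distinct_pairs)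
  then have "distinct (ws1 p r @ ws2 p r @ ws3 p r @ ws4 p r)"
    using r p by (auto simp: set_ws)
  moreover have "set (ws1 p r @ ws2 p r @ ws3 p r @ ws4 p r) \<inter> block r = {}"
    using r p by (auto simp: set_ws block_def)
  ultimately obtain F where "stacked (block r \<union> set (ws1 p r @ ws2 p r @ ws3 p r @ ws4 p r)) (block_graph p r) F"
    unfolding block_graph_def using stacked_core_fans by blast
  moreover have "vertex_set (4 * p + 1) \<subseteq> block r \<union> set (ws1 p r @ ws2 p r @ ws3 p r @ ws4 p r)"
  proof (rule vertex_set_subset_blocks)
    show "block s \<subseteq> block r \<union> set (ws1 p r @ ws2 p r @ ws3 p r @ ws4 p r)" if "s < p" for s
      using that r p by (cases "s = r") (auto simp: set_ws block_def)
  qed (use r p in \<open>auto simp: set_ws\<close>)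
  ultimately show ?thesis by blast
qed

section \<open>Every edge is covered\<close>

lemma fan_poles:
  assumes "w \<in> set ws"
  shows "{w, x} \<in> fan x y z ws" "{x, w} \<in> fan x y z ws" "{w, y} \<in> fan x y z ws" "{y, w} \<in> fan x y z ws"
  using fan_left [OF assms, of x y z] fan_right [OF assms, of y x z] by (simp_all add: insert_commute)

lemma last_graph_fan1:
  assumes "r < p" "w \<in> {Vb r 2, Ub r 2, Vb r 3, Ub r 0}"
  shows "{A, w} \<in> last_graph p" "{B, w} \<in> last_graph p"
proof -
  have w: "w \<in> set (last_list1 p)" using assms by (auto simp: set_last_lists)
  show "{A, w} \<in> last_graph p" "{B, w} \<in> last_graph p"
    unfolding last_graph_def by (intro UnI1 UnI2 fan_poles [OF w])+
qed

lemma last_graph_fan2: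
  assumes "r < p" "w \<in> {Vb r 0, Ub r 3, Vb r 1, Ub r 1}"
  shows "{Ub p 0, w} \<in> last_graph p" "{w, Vb p 0} \<in> last_graph p"
proof -
  have w: "w \<in> set (last_list2 p)" using assms by (auto simp: set_last_lists)
  show "{Ub p 0, w} \<in> last_graph p" "{w, Vb p 0} \<in> last_graph p"
    unfolding last_graph_def by (intro UnI2 fan_poles [OF w])+
qed

lemma last_graph_poles:
  "{A, B} \<in> last_graph p" "{A, Ub p 0} \<in> last_graph p" "{B, Ub p 0} \<in> last_graph p"
  "{A, Vb p 0} \<in> last_graph p" "{B, Vb p 0} \<in> last_graph p" "{Ub p 0, Vb p 0} \<in> last_graph p"
  by (simp_all add: last_graph_def)

lemma last_graph_block:
  assumes "r < p"
  shows "{Ub r 2, Vb r 2} \<in> last_graph p" "{Ub r 2, Vb r 3} \<in> last_graph p"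
    "{Ub r 3, Vb r 0} \<in> last_graph p" "{Ub r 3, Vb r 1} \<in> last_graph p"
proof -
  have r: "r \<in> set [0..<p]" using assms by simp
  have "{Vb r 2, Ub r 2} \<in> fan A B (Vb p 0) (last_list1 p)"
    "{Ub r 2, Vb r 3} \<in> fan A B (Vb p 0) (last_list1 p)"
    "{Vb r 0, Ub r 3} \<in> fan (Ub p 0) (Vb p 0) B (last_list2 p)"
    "{Ub r 3, Vb r 1} \<in> fan (Ub p 0) (Vb p 0) B (last_list2 p)"
    unfolding last_list1_def last_list2_def
    by (rule fan_consecutive_concat [OF r, of _ "[]"], simp,
        rule fan_consecutive_concat [OF r, of _ "[Vb r 2]"], simp,
        rule fan_consecutive_concat [OF r, of _ "[]"], simp,
        rule fan_consecutive_concat [OF r, of _ "[Vb r 0]"], simp)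
  then show "{Ub r 2, Vb r 2} \<in> last_graph p" "{Ub r 2, Vb r 3} \<in> last_graph p"
    "{Ub r 3, Vb r 0} \<in> last_graph p" "{Ub r 3, Vb r 1} \<in> last_graph p"
    by (simp_all add: last_graph_def insert_commute)
qed

lemma block_graph_fans:
  "w \<in> set (ws1 p r) \<Longrightarrow> i \<in> {0, 2} \<Longrightarrow> {Ub r i, w} \<in> block_graph p r"
  "w \<in> set (ws2 p r) \<Longrightarrow> i \<in> {1, 3} \<Longrightarrow> {Ub r i, w} \<in> block_graph p r \<and> {w, Ub r i} \<in> block_graph p r"
  "w \<in> set (ws3 p r) \<Longrightarrow> i \<in> {0, 1} \<Longrightarrow> {w, Vb r i} \<in> block_graph p r"
  "w \<in> set (ws4 p r) \<Longrightarrow> i \<in> {2, 3} \<Longrightarrow> {w, Vb r i} \<in> block_graph p r"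
proof -
  show "w \<in> set (ws1 p r) \<Longrightarrow> i \<in> {0, 2} \<Longrightarrow> {Ub r i, w} \<in> block_graph p r"
    unfolding block_graph_def using fan_poles(2,4) [of w "ws1 p r"] by blast
  show "w \<in> set (ws2 p r) \<Longrightarrow> i \<in> {1, 3} \<Longrightarrow> {Ub r i, w} \<in> block_graph p r \<and> {w, Ub r i} \<in> block_graph p r"
    unfolding block_graph_def using fan_poles [of w "ws2 p r"] by blast
  show "w \<in> set (ws3 p r) \<Longrightarrow> i \<in> {0, 1} \<Longrightarrow> {w, Vb r i} \<in> block_graph p r"
    unfolding block_graph_def using fan_poles(1,3) [of w "ws3 p r"] by blast
  show "w \<in> set (ws4 p r) \<Longrightarrow> i \<in> {2, 3} \<Longrightarrow> {w, Vb r i} \<in> block_graph p r"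
    unfolding block_graph_def using fan_poles(1,3) [of w "ws4 p r"] by blast
qed

lemma block_graph_shift:
  "{A, Vb (shift p 1 r) 0} \<in> block_graph p r" "{A, Vb (shift p 1 r) 1} \<in> block_graph p r"
  "{B, Vb (shift p 1 r) 1} \<in> block_graph p r" "{B, Vb (shift p 2 r) 0} \<in> block_graph p r"
  unfolding block_graph_def ws2_def by (simp_all add: insert_commute)

lemma edge_set_subset_family:
  assumes p: "p \<ge> 3"
  shows "edge_set (4 * p + 1) \<subseteq> last_graph p \<union> (\<Union>r<p. block_graph p r)" (is "_ \<subseteq> ?E")
proof -
  have L: "e \<in> last_graph p \<Longrightarrow> e \<in> ?E" for e by blast
  have G: "e \<in> block_graph p r \<Longrightarrow> r < p \<Longrightarrow> e \<in> ?E" for e r by blast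
  have AB: "{A, Ub r i} \<in> ?E" "{A, Vb r i} \<in> ?E" "{B, Ub r i} \<in> ?E" "{B, Vb r i} \<in> ?E"
    if r: "r < p" and i: "i \<in> {0, 1, 2, 3}" for r i
  proof -
    have U: "{c, Ub r i} \<in> ?E" if c: "c = A \<or> c = B" for c
    proof (cases "i \<in> {0, 2}")
      case True
      then have "Ub r i \<in> {Vb r 2, Ub r 2, Vb r 3, Ub r 0}" by blast
      from L [OF last_graph_fan1(1) [OF r this]] L [OF last_graph_fan1(2) [OF r this]] c
      show ?thesis by metis
    next
      case False
      then have "i \<in> {1, 3}" using i by blast
      moreover have "c \<in> set (ws2 p r)" using c unfolding set_ws(2) [OF r p] by blast
      ultimately show ?thesis by (intro G [OF conjunct2 [OF block_graph_fans(2)] r])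
    qed
    show "{A, Ub r i} \<in> ?E" "{B, Ub r i} \<in> ?E" by (rule U, simp)+
    \<comment> \<open>\<open>s\<close> and \<open>t\<close> are the blocks whose first and second
      cyclic successor is \<open>r\<close>; their graphs contain the edges from \<open>A\<close> and
      \<open>B\<close> to \<open>Vb r 0\<close> and \<open>Vb r 1\<close>.\<close>
    obtain s where s: "s < p" "shift p 1 s = r" using shift_surj(1) [OF r p] by blast
    obtain t where t: "t < p" "shift p 2 t = r" using shift_surj(2) [OF r p] by blast
    have V: "{c, Vb r i} \<in> ?E" if c: "c = A \<or> c = B" for c
    proof (cases "i \<in> {2, 3}")
      case True
      then have "Vb r i \<in> {Vb r 2, Ub r 2, Vb r 3, Ub r 0}" by blast
      from L [OF last_graph_fan1(1) [OF r this]] L [OF last_graph_fan1(2) [OF r this]] c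
      show ?thesis by metis
    next
      case False
      then have "i = 0 \<or> i = 1" using i by blast
      then show ?thesis
        using c G [OF block_graph_shift(1) [of p s] s(1)] G [OF block_graph_shift(2) [of p s] s(1)]
          G [OF block_graph_shift(3) [of p s] s(1)] G [OF block_graph_shift(4) [of p t] t(1)]
        unfolding s(2) t(2) by metis
    qed
    show "{A, Vb r i} \<in> ?E" "{B, Vb r i} \<in> ?E" by (rule V, simp)+
  qed
  have extra: "{Ub p 0, Vb r i} \<in> ?E" "{Ub r i, Vb p 0} \<in> ?E"
    if r: "r < p" and i: "i \<in> {0, 1, 2, 3}" for r i
  proof -
    show "{Ub p 0, Vb r i} \<in> ?E"
    proof (cases "i \<in> {2, 3}")
      case True
      then show ?thesis by (intro G [OF block_graph_fans(4) r]) (simp_all only: set_ws, simp)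
    next
      case False
      then have "Vb r i \<in> {Vb r 0, Ub r 3, Vb r 1, Ub r 1}" using i by blast
      then show ?thesis by (rule L [OF last_graph_fan2(1) [OF r]])
    qed
    show "{Ub r i, Vb p 0} \<in> ?E"
    proof (cases "i \<in> {0, 2}")
      case True
      then show ?thesis by (intro G [OF block_graph_fans(1) r]) (simp_all only: set_ws, simp)
    next
      case False
      then have "Ub r i \<in> {Vb r 0, Ub r 3, Vb r 1, Ub r 1}" using i by blast
      then show ?thesis by (rule L [OF last_graph_fan2(2) [OF r]])
    qed
  qed
  have same: "{Ub r i, Vb r k} \<in> ?E"
    if r: "r < p" and i: "i \<in> {0, 1, 2, 3}" and k: "k \<in> {0, 1, 2, 3}" for r i k
  proof -
    have "{Ub r i, Vb r k} \<in> last_graph p \<or> {Ub r i, Vb r k} \<in> core_edges r"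
      using i k unfolding insert_iff empty_iff
      by (elim disjE FalseE; hypsubst)
        (simp_all add: core_edges_def last_graph_block [OF r] del: One_nat_def)
    then show ?thesis
    proof
      assume "{Ub r i, Vb r k} \<in> core_edges r"
      then have "{Ub r i, Vb r k} \<in> block_graph p r" by (simp only: block_graph_def Un_iff simp_thms)
      then show ?thesis by (rule G [OF _ r])
    qed (rule L)
  qed
  have different: "{Ub r i, Vb s k} \<in> ?E"
    if r: "r < p" and s: "s < p" and "r \<noteq> s" and i: "i \<in> {0, 1, 2, 3}" and k: "k \<in> {0, 1, 2, 3}" for r s i k
  proof -
    \<comment> \<open>The four cases correspond to the four fans: the first two use the graph of
      block \<open>r\<close>, the last two that of block \<open>s\<close>.\<close>
    consider "i \<in> {0, 2}" "k \<in> {2, 3}" | "i \<in> {1, 3}" "k \<in> {0, 1}" | "i \<in> {0, 2}" "k \<in> {0, 1}"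
      | "i \<in> {1, 3}" "k \<in> {2, 3}"
      using i k by blast
    then show ?thesis
    proof cases
      case 1
      then have "Vb s k \<in> set (ws1 p r)" using s \<open>r \<noteq> s\<close> unfolding set_ws by blast
      from G [OF block_graph_fans(1) [OF this 1(1)] r] show ?thesis .
    next
      case 2
      then have "Vb s k \<in> set (ws2 p r)" using s \<open>r \<noteq> s\<close> unfolding set_ws(2) [OF r p] by blast
      from G [OF conjunct1 [OF block_graph_fans(2) [OF this 2(1)]] r] show ?thesis .
    next
      case 3
      then have "Ub r i \<in> set (ws3 p s)" using r \<open>r \<noteq> s\<close> unfolding set_ws by blast
      from G [OF block_graph_fans(3) [OF this 3(2)] s] show ?thesis .
    next
      case 4
      then have "Ub r i \<in> set (ws4 p s)" using r \<open>r \<noteq> s\<close> unfolding set_ws by blast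
      from G [OF block_graph_fans(4) [OF this 4(2)] s] show ?thesis .
    qed
  qed
  show ?thesis
  proof (rule edge_set_subsetI)
    show "{A, B} \<in> ?E" by (rule L [OF last_graph_poles(1)])
    show "\<forall>j<4 * p + 1. {A, U j} \<in> ?E \<and> {A, V j} \<in> ?E \<and> {B, U j} \<in> ?E \<and> {B, V j} \<in> ?E"
    proof (intro allI impI)
      fix j assume "j < 4 * p + 1"
      then show "{A, U j} \<in> ?E \<and> {A, V j} \<in> ?E \<and> {B, U j} \<in> ?E \<and> {B, V j} \<in> ?E"
      proof (cases rule: block_cases)
        case 1
        then show ?thesis using last_graph_poles [of p] L by simp
      next
        case (2 r i)
        then show ?thesis using AB [of r i] by simp
      qed
    qed
    show "\<forall>i<4 * p + 1. \<forall>j<4 * p + 1. {U i, V j} \<in> ?E"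
    proof (intro allI impI)
      fix i j assume ij: "i < 4 * p + 1" "j < 4 * p + 1"
      from ij(1) show "{U i, V j} \<in> ?E"
      proof (cases rule: block_cases)
        case 1
        note i = this
        from ij(2) show ?thesis
        proof (cases rule: block_cases)
          case 1
          then show ?thesis using i L [OF last_graph_poles(6)] by simp
        next
          case (2 s k)
          then show ?thesis using i extra(1) [of s k] by simp
        qed
      next
        case (2 r i')
        note i = this
        from ij(2) show ?thesis
        proof (cases rule: block_cases)
          case 1
          then show ?thesis using i extra(2) [of r i'] by simp
        next
          case (2 s k)
          then show ?thesis using i same [of r i' k] different [of r s i' k] by (cases "r = s") simp_all
        qed
      qed
    qed
  qed
qed

lemma planar_cover_family:
  assumes p: "p \<ge> 3" and n: "n \<le> 4 * p + 1"
  obtains \<H> where "planar_cover (complete_multipartite [1, 1, n, n]) \<H>" "card \<H> \<le> p + 1"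
proof -
  let ?\<E> = "insert (last_graph p) (block_graph p ` {..<p})"
  have "\<exists>S F. vertex_set (4 * p + 1) \<subseteq> S \<and> stacked S E F" if "E \<in> ?\<E>" for E
    using that stacked_last_graph stacked_block_graph [OF _ p] by auto
  moreover have "edge_set (4 * p + 1) \<subseteq> \<Union> ?\<E>"
    using edge_set_subset_family [OF p] by simp
  ultimately obtain \<H> where "planar_cover (complete_multipartite [1, 1, n, n]) \<H>" "card \<H> \<le> card ?\<E>"
    using planar_cover_of_stacked [OF n, of ?\<E>] by blast
  moreover have "card ?\<E> \<le> p + 1"
    using card_insert_le_m1 card_image_le [of "{..<p}" "block_graph p"] by (simp add: card_insert_if)
  ultimately show thesis using that by fastforce
qed

subsection \<open>The thickness\<close>

text \<open>With \<open>2 * n + 2\<close> vertices, the bound for bipartite plane graphs is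
  \<open>2 * (2 * n + 2) - 4 = 4 * n\<close>.\<close>

lemma card_bipartite_edges_le:
  assumes H: "subgraph H (complete_multipartite [1, 1, n, n])" "planar H" and n: "n \<ge> 1"
    and X: "\<And>e. e \<in> E \<Longrightarrow> \<exists>u v. u \<in> X \<and> v \<notin> X \<and> e = {u, v}" and E: "E \<subseteq> edges H"
  shows "card E \<le> 4 * n"
proof -
  obtain p \<gamma> where d: "plane_drawing H p \<gamma>" using H(2) by (auto simp: planar_def)
  have V: "verts H \<subseteq> vertex_set n" using H(1) unfolding subgraph_def verts_K by simp
  have edge: "e \<subseteq> verts H" "card e = 2" if "e \<in> E" for e
    using H(1) E that by (auto simp: subgraph_def simple_graph_def)
  have fin: "finite (verts H)" using H(1) by (simp add: subgraph_def simple_graph_def)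
  have sub: "\<Union>E \<subseteq> verts H" using edge(1) by blast
  interpret plane_edges E p \<gamma>
  proof
    have "E \<subseteq> Pow (verts H)" using edge(1) by blast
    then show "finite E" using fin by (simp add: finite_subset)
    show "card e = 2" if "e \<in> E" for e by (rule edge(2) [OF that])
    show "inj_on p (\<Union>E)" using d sub by (auto simp: plane_drawing_def intro: inj_on_subset)
    show "arc (\<gamma> e)" "{pathstart (\<gamma> e), pathfinish (\<gamma> e)} = p ` e" if "e \<in> E" for e
      using d E that by (auto simp: plane_drawing_def)
    show "path_image (\<gamma> e) \<inter> path_image (\<gamma> f) = p ` (e \<inter> f)" if "e \<in> E" "f \<in> E" "e \<noteq> f" for e f
      using d that subsetD [OF E] by (simp add: plane_drawing_def)
    show "path_image (\<gamma> e) \<inter> p ` \<Union>E = p ` e" if "e \<in> E" for e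
    proof -
      have "path_image (\<gamma> e) \<inter> p ` verts H = p ` e"
        using d subsetD [OF E that] by (simp add: plane_drawing_def)
      moreover have "p ` e \<subseteq> p ` \<Union>E" "p ` \<Union>E \<subseteq> p ` verts H" using that sub by blast+
      ultimately show ?thesis by blast
    qed
  qed
  have "card (vertex_set n) = 2 * n + 2"
    by (subst vertex_set_def, subst card_Un_disjoint) (auto simp: card_cartesian_product)
  moreover have "finite (vertex_set n)" by (simp add: vertex_set_def)
  ultimately show ?thesis
    using bipartite_card_bound [OF X, of "vertex_set n"] sub V n by fastforce
qed

lemma planar_cover_card_ge:
  assumes cover: "planar_cover (complete_multipartite [1, 1, n, n]) \<H>" and n: "n \<ge> 1"
  shows "n + 3 \<le> 4 * card \<H>"
proof -
  \<comment> \<open>The sides of a spanning complete bipartite subgraph with \<open>n + 1\<close>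
    vertices each: only the edges from \<open>A\<close> to the \<open>U j\<close> and from
    \<open>B\<close> to the \<open>V j\<close> are left out.\<close>
  define X where "X = insert A (U ` {..<n})"
  define Y where "Y = insert B (V ` {..<n})"
  define D where "D = (\<lambda>(u, v). {u, v}) ` (X \<times> Y)"
  have "card X = n + 1" "card Y = n + 1"
    by (simp_all add: X_def Y_def card_insert_if card_image inj_on_def image_iff)
  moreover have "X \<inter> Y = {}" by (auto simp: X_def Y_def)
  then have "inj_on (\<lambda>(u, v). {u, v}) (X \<times> Y)"
    by (auto simp: inj_on_def doubleton_eq_iff)
  ultimately have "(n + 1) * (n + 1) = card D"
    by (simp add: D_def card_image card_cartesian_product)
  also have "D \<subseteq> (\<Union>H\<in>\<H>. edges H \<inter> D)"
  proof -
    have "D \<subseteq> edge_set n"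
    proof
      fix e assume "e \<in> D"
      then obtain u v where uv: "e = {u, v}" "u \<in> X" "v \<in> Y" by (auto simp: D_def)
      then have "u \<in> vertex_set n" "v \<in> vertex_set n" "fst u < fst v \<or> fst v < fst u"
        by (auto simp: X_def Y_def mem_vertex_set)
      then show "e \<in> edge_set n"
        using edge_setI [of u n v] edge_setI [of v n u] by (auto simp: uv(1) insert_commute)
    qed
    also have "\<dots> = (\<Union>H\<in>\<H>. edges H)"
      using cover by (metis edges_K graph.sel(2) graph_Union_def planar_cover_def)
    finally show ?thesis by blast
  qed
  then have "card D \<le> card (\<Union>H\<in>\<H>. edges H \<inter> D)"
    using cover by (intro card_mono finite_UN_I) (auto simp: planar_cover_def D_def X_def Y_def)
  also have "\<dots> \<le> (\<Sum>H\<in>\<H>. card (edges H \<inter> D))"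
    using cover by (intro card_UN_le) (simp add: planar_cover_def)
  also have "\<dots> \<le> (\<Sum>H\<in>\<H>. 4 * n)"
  proof (rule sum_mono)
    fix H assume H: "H \<in> \<H>"
    have "\<exists>u v. u \<in> X \<and> v \<notin> X \<and> e = {u, v}" if "e \<in> edges H \<inter> D" for e
    proof -
      have "e \<in> D" using that by simp
      then obtain u v where "e = {u, v}" "u \<in> X" "v \<in> Y" by (auto simp: D_def)
      then show ?thesis using \<open>X \<inter> Y = {}\<close> by blast
    qed
    with H cover n show "card (edges H \<inter> D) \<le> 4 * n"
      by (intro card_bipartite_edges_le [of H n _ X]) (simp_all add: planar_cover_def)
  qed
  finally have "(n + 1) * (n + 1) \<le> n * (4 * card \<H>)" by (simp add: mult_ac)
  \<comment> \<open>If \<open>4 * card \<H> \<le> n + 2\<close>, the right-hand side would be at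
    most \<open>n * (n + 2)\<close>, one less than \<open>(n + 1) * (n + 1)\<close>.\<close>
  moreover have "n * (4 * card \<H>) \<le> n * (n + 2)" if "4 * card \<H> \<le> n + 2"
    using that by (rule mult_le_mono2)
  ultimately show ?thesis by (cases "4 * card \<H> \<le> n + 2") (fastforce simp: algebra_simps)+
qed

lemma planar_cover_exists:
  assumes "n \<le> 4 * p + 1"
  obtains \<H> where "planar_cover (complete_multipartite [1, 1, n, n]) \<H>" "card \<H> \<le> p + 1"
proof -
  consider "p = 0" | "p = 1" | "p = 2" | "p \<ge> 3" by linarith
  then show thesis
  proof cases
    case 1
    show ?thesis
      by (rule planar_cover_of_triangulations [OF triangulation_cover_1, of n])
        (use assms 1 that in simp_all)
  next
    case 2
    show ?thesis
      by (rule planar_cover_of_triangulations [OF triangulation_cover_5, of n])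
        (use assms 2 that in simp_all)
  next
    case 3
    show ?thesis
      by (rule planar_cover_of_triangulations [OF triangulation_cover_9, of n])
        (use assms 3 that in simp_all)
  next
    case 4
    then show ?thesis using planar_cover_family [OF _ assms] that by blast
  qed
qed

theorem theorem4p1:
  fixes n :: nat
  assumes "n \<ge> 1"
  shows "int (thickness (complete_multipartite [1, 1, n, n])) = \<lceil>(real n + 3) / 4\<rceil>"
proof -
  let ?G = "complete_multipartite [1, 1, n, n]"
  \<comment> \<open>The least \<open>p\<close> with \<open>n \<le> 4 * p + 1\<close>.\<close>
  define p where "p = (n + 2) div 4"
  have "n \<le> 4 * p + 1" by (simp add: p_def)
  then obtain \<H> where \<H>: "planar_cover ?G \<H>" "card \<H> \<le> p + 1"
    by (rule planar_cover_exists)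
  have "thickness ?G \<le> p + 1"
    using thickness_le [OF \<H>(1)] \<H>(2) by (rule order_trans)
  moreover have "4 * p \<le> n + 2" by (simp add: p_def)
  ultimately have "4 * thickness ?G \<le> n + 6" by linarith
  moreover have "n + 3 \<le> 4 * thickness ?G"
    using thickness_attained [OF \<H>(1)] planar_cover_card_ge [OF _ assms] by metis
  \<comment> \<open>The bounds \<open>n + 3\<close> and \<open>n + 6\<close> on four times the
    thickness confine it to the ceiling.\<close>
  ultimately show ?thesis by (simp add: eq_commute ceiling_eq_iff)
qed

end
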